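(* Let $I \subset S$ be a bihomogeneous ideal. Then there is an integer $s$ with $0 \leq s \leq \operatorname{cd}_{\mathfrak{m}_x}(I) - 1$ such that $\operatorname{reg}(I) + (s,0) \subset \operatorname{x-reg}(I)$.
   Context: Let $\mathbf{k}$ be a field of characteristic $0$ and $S=\mathbf{k}[x_0,\dots,x_n,y_0,\dots,y_m]$ with the standard $\mathbb{Z}^2$-grading $\deg(x_i)=(1,0)$, $\deg(y_j)=(0,1)$. A polynomial is bihomogeneous of bidegree $(a,b)$ if all its terms have bidegree $(a,b)$, and an ideal of $S$ is bihomogeneous if it can be generated by bihomogeneous polynomials. For pairs in $\mathbb{Z}^2$, $(a',b')\geq(a,b)$ means $a'\geq a$ and $b'\geq b$. Let $\mathfrak{m}_x=(x_0,\dots,x_n)$, $\mathfrak{m}_y=(y_0,\dots,y_m)$ and $\mathfrak{b}=\mathfrak{m}_x\mathfrak{m}_y$. For an ideal $J$, $H^i_J(I)$ denotes the $i$-th local cohomology module of $I$ with respect to $J$. The bigraded Castelnuovo-Mumford regularity $\operatorname{reg}(I)$ is the set of $(a,b)\in\mathbb{Z}^2$ such that for all $i\geq 1$, all $\lambda_x,\lambda_y\in\mathbb{Z}_{\geq 0}$ with $\lambda_x+\lambda_y=i-1$, and all $(a',b')\geq(a-\lambda_x,b-\lambda_y)$, one has $H^i_{\mathfrak{b}}(I)_{(a',b')}=0$. The partial regularity region $\operatorname{x-reg}(I)$ is the set of $(a,b)\in\mathbb{Z}^2$ such that for all $i\geq 1$ and all $(a',b')\geq(a-i+1,b)$ one has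 $H^i_{\mathfrak{m}_x}(I)_{(a',b')}=0$. The cohomological dimension is $\operatorname{cd}_{\mathfrak{m}_x}(I)=\max(\{0\}\cup\{i\in\mathbb{Z}_{>0} : H^i_{\mathfrak{m}_x}(I)\neq 0\})$.
   Formalization: The bihomogeneous ideal I is assumed nonzero: for I = 0 all local cohomology vanishes, so the cohomological dimension is 0 and no integer s with 0 ≤ s ≤ cd − 1 exists. *)

theory Defs
  imports Complex_Main "HOL-Library.Poly_Mapping" "HOL-Library.Product_Lexorder"
begin

text \<open>
  The polynomial ring \<open>S = k[x\<^sub>0,\<dots>,x\<^sub>n,y\<^sub>0,\<dots>,y\<^sub>m]\<close>: the \<open>x\<close>-variables are indexed by a finite linearly
  ordered type \<open>'n\<close> with \<open>n + 1\<close> elements and the \<open>y\<close>-variables by such a type \<open>'m\<close> with \<open>m + 1\<close>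
  elements. \<open>Inl i\<close> stands for \<open>x\<^sub>i\<close> and \<open>Inr j\<close> for \<open>y\<^sub>j\<close>. All localizations that occur are at
  monomials, so they are formed inside the ring of Laurent polynomials in the same variables.
\<close>

type_synonym ('n, 'm, 'k) bipoly = "('n + 'm \<Rightarrow>\<^sub>0 nat) \<Rightarrow>\<^sub>0 'k"

type_synonym ('n, 'm, 'k) bilaurent = "('n + 'm \<Rightarrow>\<^sub>0 int) \<Rightarrow>\<^sub>0 'k"

subsection \<open>The bigrading\<close>

definition bidegree :: "('n::finite + 'm::finite \<Rightarrow>\<^sub>0 'e::comm_monoid_add) \<Rightarrow> 'e \<times> 'e" where
  "bidegree t = ((\<Sum>i\<in>UNIV. Poly_Mapping.lookup t (Inl i)), (\<Sum>j\<in>UNIV. Poly_Mapping.lookup t (Inr j)))"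

text \<open>Used for polynomials (\<open>'e = nat\<close>) and for Laurent polynomials (\<open>'e = int\<close>).\<close>

definition bihomogeneous ::
  "'e \<times> 'e \<Rightarrow> (('n::finite + 'm::finite \<Rightarrow>\<^sub>0 'e::comm_monoid_add) \<Rightarrow>\<^sub>0 'k::zero) \<Rightarrow> bool" where
  "bihomogeneous d p \<longleftrightarrow> (\<forall>t\<in>Poly_Mapping.keys p. bidegree t = d)"

definition bihomogeneous_ideal :: "('n::finite, 'm::finite, 'k::comm_ring_1) bipoly set \<Rightarrow> bool" where
  "bihomogeneous_ideal I \<longleftrightarrow>
     (\<exists>B. (\<forall>f\<in>B. \<exists>d. bihomogeneous d f) \<and> I = module.span (*) B)"

subsection \<open>Localization of an ideal at a monomial\<close>

definition to_laurent :: "('n, 'm, 'k::comm_ring_1) bipoly \<Rightarrow> ('n, 'm, 'k) bilaurent" where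
  "to_laurent p =
     (\<Sum>t\<in>Poly_Mapping.keys p. Poly_Mapping.single (Poly_Mapping.map int t) (Poly_Mapping.lookup p t))"

text \<open>
  For the monomial \<open>f\<close> with exponent vector \<open>u\<close>, the localization \<open>I\<^sub>f\<close> is \<open>{g / f\<^sup>k | g \<in> I, k \<ge> 0}\<close>. As \<open>I\<close> is
  torsion free over \<open>S\<close>, it embeds into the Laurent polynomials.
\<close>

definition localization ::
  "('n, 'm, 'k::comm_ring_1) bipoly set \<Rightarrow> ('n + 'm \<Rightarrow>\<^sub>0 int) \<Rightarrow> ('n, 'm, 'k) bilaurent set" where
  "localization I u = {Poly_Mapping.single (- u) 1 ^ k * to_laurent g | k g. g \<in> I}"

subsection \<open>Local cohomology\<close>

text \<open>
  \<open>H\<^sup>i\<^sub>J(I)\<close> is the \<open>i\<close>-th cohomology of the Cech complex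
  \<open>0 \<rightarrow> I \<rightarrow> \<Oplus>\<^sub>a I\<^bsub>f(a)\<^esub> \<rightarrow> \<Oplus>\<^sub>{\<^sub>a\<^sub><\<^sub>b\<^sub>} I\<^bsub>f(a)f(b)\<^esub> \<rightarrow> \<dots>\<close>
  where the monomials \<open>f(a)\<close>, indexed by a finite linearly ordered type \<open>'g\<close>, generate the ideal \<open>J\<close>.
  The family \<open>f\<close> below consists of the exponent vectors of these generators.
  A \<open>p\<close>-cochain \<open>c\<close> has a component \<open>c A\<close> in the localization at \<open>\<Prod>\<^sub>{\<^sub>a\<^sub>\<in>\<^sub>A\<^sub>} f(a)\<close> for each \<open>A\<close> with \<open>p\<close>
  elements; the components at all other sets are set to 0.
\<close>

definition cech_cochains ::
  "('g::finite \<Rightarrow> ('n + 'm \<Rightarrow>\<^sub>0 int)) \<Rightarrow> ('n, 'm, 'k::comm_ring_1) bipoly set \<Rightarrow> nat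
    \<Rightarrow> ('g set \<Rightarrow> ('n, 'm, 'k) bilaurent) set" where
  "cech_cochains f I p =
     {c. \<forall>A. if card A = p then c A \<in> localization I (\<Sum>a\<in>A. f a) else c A = 0}"

definition cech_differential ::
  "nat \<Rightarrow> ('g::{finite,linorder} set \<Rightarrow> ('n, 'm, 'k::comm_ring_1) bilaurent)
    \<Rightarrow> ('g set \<Rightarrow> ('n, 'm, 'k) bilaurent)" where
  "cech_differential p c =
     (\<lambda>A. if card A = Suc p then (\<Sum>a\<in>A. (-1) ^ card {b\<in>A. b < a} * c (A - {a})) else 0)"

definition cech_cocycles ::
  "('g::{finite,linorder} \<Rightarrow> ('n + 'm \<Rightarrow>\<^sub>0 int)) \<Rightarrow> ('n, 'm, 'k::comm_ring_1) bipoly set \<Rightarrow> nat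
    \<Rightarrow> ('g set \<Rightarrow> ('n, 'm, 'k) bilaurent) set" where
  "cech_cocycles f I i = {c \<in> cech_cochains f I i. cech_differential i c = (\<lambda>A. 0)}"

definition cech_coboundaries ::
  "('g::{finite,linorder} \<Rightarrow> ('n + 'm \<Rightarrow>\<^sub>0 int)) \<Rightarrow> ('n, 'm, 'k::comm_ring_1) bipoly set \<Rightarrow> nat
    \<Rightarrow> ('g set \<Rightarrow> ('n, 'm, 'k) bilaurent) set" where
  "cech_coboundaries f I i =
     (case i of 0 \<Rightarrow> {\<lambda>A. 0} | Suc p \<Rightarrow> cech_differential p ` cech_cochains f I p)"

definition cohomologous ::
  "('g::{finite,linorder} \<Rightarrow> ('n + 'm \<Rightarrow>\<^sub>0 int)) \<Rightarrow> ('n, 'm, 'k::comm_ring_1) bipoly set \<Rightarrow> nat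
    \<Rightarrow> ('g set \<Rightarrow> ('n, 'm, 'k) bilaurent) rel" where
  "cohomologous f I i =
     {(c, c'). c \<in> cech_cocycles f I i \<and> c' \<in> cech_cocycles f I i \<and>
        (\<lambda>A. c A - c' A) \<in> cech_coboundaries f I i}"

definition local_cohomology ::
  "('g::{finite,linorder} \<Rightarrow> ('n + 'm \<Rightarrow>\<^sub>0 int)) \<Rightarrow> ('n, 'm, 'k::comm_ring_1) bipoly set \<Rightarrow> nat
    \<Rightarrow> ('g set \<Rightarrow> ('n, 'm, 'k) bilaurent) set set" where
  "local_cohomology f I i = cech_cocycles f I i // cohomologous f I i"

text \<open>The zero element of the quotient, that is, the class of the zero cocycle.\<close>

definition zero_class ::
  "('g::{finite,linorder} \<Rightarrow> ('n + 'm \<Rightarrow>\<^sub>0 int)) \<Rightarrow> ('n, 'm, 'k::comm_ring_1) bipoly set \<Rightarrow> nat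
    \<Rightarrow> ('g set \<Rightarrow> ('n, 'm, 'k) bilaurent) set" where
  "zero_class f I i = cohomologous f I i `` {\<lambda>A. 0}"

text \<open>The component of bidegree \<open>d\<close>: the classes represented by a cocycle that is bihomogeneous of bidegree \<open>d\<close>.\<close>

definition local_cohomology_graded ::
  "('g::{finite,linorder} \<Rightarrow> ('n::finite + 'm::finite \<Rightarrow>\<^sub>0 int)) \<Rightarrow> ('n, 'm, 'k::comm_ring_1) bipoly set
    \<Rightarrow> nat \<Rightarrow> int \<times> int \<Rightarrow> ('g set \<Rightarrow> ('n, 'm, 'k) bilaurent) set set" where
  "local_cohomology_graded f I i d =
     {cohomologous f I i `` {c} | c. c \<in> cech_cocycles f I i \<and> (\<forall>A. bihomogeneous d (c A))}"

text \<open>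
  The generators \<open>x\<^sub>i\<close> of \<open>\<mm>\<^sub>x\<close> and the generators \<open>x\<^sub>i y\<^sub>j\<close> of \<open>\<bb> = \<mm>\<^sub>x \<mm>\<^sub>y\<close>. The latter are ordered
  lexicographically; this affects the signs in the Cech complex only.
\<close>

definition mx_gens :: "'n::finite \<Rightarrow> ('n + 'm::finite \<Rightarrow>\<^sub>0 int)" where
  "mx_gens i = Poly_Mapping.single (Inl i) 1"

definition b_gens :: "'n::finite \<times> 'm::finite \<Rightarrow> ('n + 'm \<Rightarrow>\<^sub>0 int)" where
  "b_gens = (\<lambda>(i, j). Poly_Mapping.single (Inl i) 1 + Poly_Mapping.single (Inr j) 1)"

subsection \<open>Regularity regions and cohomological dimension\<close>

text \<open>
  The order on \<open>\<int>\<^sup>2\<close> used here is the componentwise one and is always written out, because \<open>\<le>\<close> on pairs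
  is the lexicographic order.
\<close>

definition reg ::
  "('n::{finite,linorder}, 'm::{finite,linorder}, 'k::comm_ring_1) bipoly set \<Rightarrow> (int \<times> int) set" where
  "reg I = {(a, b). \<forall>i\<ge>1. \<forall>lx ly :: nat. lx + ly = i - 1 \<longrightarrow>
     (\<forall>a' b'. a' \<ge> a - int lx \<and> b' \<ge> b - int ly \<longrightarrow>
        local_cohomology_graded b_gens I i (a', b') = {zero_class b_gens I i})}"

definition x_reg ::
  "('n::{finite,linorder}, 'm::finite, 'k::comm_ring_1) bipoly set \<Rightarrow> (int \<times> int) set" where
  "x_reg I = {(a, b). \<forall>i\<ge>1. \<forall>a' b'. a' \<ge> a - int i + 1 \<and> b' \<ge> b \<longrightarrow>
     local_cohomology_graded mx_gens I i (a', b') = {zero_class mx_gens I i}}"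

definition cd_mx :: "('n::{finite,linorder}, 'm::finite, 'k::comm_ring_1) bipoly set \<Rightarrow> nat" where
  "cd_mx I = Max ({0} \<union> {i. i > 0 \<and> local_cohomology mx_gens I i \<noteq> {zero_class mx_gens I i}})"

end

theory Submission
  imports Defs "HOL-Library.Option_ord"
begin

text \<open>
  The shift \<open>s = 0\<close> always works: \<open>reg(I) \<subseteq> x-reg(I)\<close> (\<open>reg_subset_x_reg\<close>). That \<open>0\<close> is admissible,
  that is \<open>cd(I) \<ge> 1\<close>, holds because \<open>H\<^sup>n\<^sup>+\<^sup>1\<close> with support in \<open>\<mm>\<^sub>x\<close> is nonzero: a nonzero element of \<open>I\<close>
  divided by a high power of \<open>x\<^sub>0 \<cdots> x\<^sub>n\<close> has only terms with all \<open>x\<close>-exponents negative, while a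
  coboundary is a sum of elements each of which is regular in some \<open>x\<^sub>i\<close> (\<open>top_cohomology_nonzero\<close>).

  For the inclusion, let \<open>(a, b) \<in> reg(I)\<close>. Taking \<open>\<lambda>\<^sub>y = 0\<close> in the definition, \<open>H\<^sup>i\<^sub>\<bb>(I)\<close> vanishes in
  the bidegrees \<open>(a', b')\<close> with \<open>a' \<ge> a - i + 1\<close> and \<open>b' \<ge> b\<close>. It suffices to see that in a bidegree
  with \<open>b' \<ge> b\<close> and any \<open>a'\<close>, vanishing of \<open>H\<^sup>i\<^sub>\<bb>(I)\<close> implies vanishing of \<open>H\<^sup>i\<close> with support in \<open>\<mm>\<^sub>x\<close>.
  Geometrically, the open sets \<open>D(\<bb>) \<subseteq> D(\<mm>\<^sub>x)\<close> have the same cohomology in these bidegrees: the larger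
  one is covered by the \<open>D(x\<^sub>k)\<close>, and over each of them, and over their intersections, the cohomology
  with support in \<open>\<bb>\<close> vanishes. Indeed the Cech complex of \<open>\<bb>\<close> localized at \<open>x\<^sub>k\<close> is, in bidegree
  \<open>(a', b')\<close>, the direct limit of the parts of the Cech complex in bidegrees \<open>(a' + N, b')\<close> along
  multiplication by \<open>x\<^sub>k\<close>, and for \<open>N\<close> large these parts are exact (\<open>exact_localization\<close>).

  The comparison itself works with one Cech complex for the combined family of generators \<open>x\<^sub>i\<close> and
  \<open>x\<^sub>i y\<^sub>j\<close>, restricted to subfamilies \<open>F\<close>. Adding a generator \<open>g\<close> to \<open>F\<close> replaces the complex by the
  cone of the map to its localization at \<open>g\<close>, hence it changes no cohomology when that localization is exact
  (\<open>exact_insert\<close>, \<open>exact_remove\<close>). Starting from the \<open>x\<^sub>i y\<^sub>j\<close>, the \<open>x\<^sub>k\<close> may be added by the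
  previous paragraph; afterwards the \<open>x\<^sub>i y\<^sub>j\<close> may be removed, since the complex of a family
  containing \<open>x\<^sub>i\<close> is contractible once \<open>x\<^sub>i y\<^sub>j\<close> is inverted (\<open>exact_if_unit\<close>). The subfamily of
  the \<open>x\<^sub>i\<close> remains.
\<close>

section \<open>Cech complexes and mapping cones\<close>

text \<open>
  The Cech differential in all degrees at once. The degree of a cochain is recorded by its support
  (sets of one cardinality), so a single formula serves all degrees.
\<close>

definition coboundary :: "('g::linorder set \<Rightarrow> 'v::comm_ring_1) \<Rightarrow> 'g set \<Rightarrow> 'v" where
  "coboundary c A = (\<Sum>a\<in>A. (-1) ^ card {b\<in>A. b < a} * c (A - {a}))"

text \<open>
  Only the variables that are inverted matter for a localization at a monomial. Hence \<open>M W\<close> stands for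
  the localization at all variables in \<open>W\<close>, and \<open>\<sigma> g\<close> for the variables dividing the generator \<open>g\<close>. The
  cochains belong to the generators in \<open>F\<close> and have coefficients in the localization at \<open>V\<close>.
  The degree \<open>p\<close> is an integer so that the predecessor of degree \<open>0\<close> carries only the zero cochain.
\<close>

definition cech_cochain ::
  "('w set \<Rightarrow> 'v::comm_ring_1 set) \<Rightarrow> ('g \<Rightarrow> 'w set) \<Rightarrow> 'g set \<Rightarrow> 'w set \<Rightarrow> int \<Rightarrow> ('g set \<Rightarrow> 'v) \<Rightarrow> bool" where
  "cech_cochain M \<sigma> F V p c \<longleftrightarrow>
     (\<forall>A\<subseteq>F. c A \<in> M (V \<union> \<Union>(\<sigma> ` A)) \<and> (c A \<noteq> 0 \<longrightarrow> int (card A) = p))"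

definition cech_exact ::
  "('w set \<Rightarrow> 'v::comm_ring_1 set) \<Rightarrow> ('g::linorder \<Rightarrow> 'w set) \<Rightarrow> 'g set \<Rightarrow> 'w set \<Rightarrow> int \<Rightarrow> bool" where
  "cech_exact M \<sigma> F V p \<longleftrightarrow>
     (\<forall>c. cech_cochain M \<sigma> F V p c \<and> (\<forall>A\<subseteq>F. coboundary c A = 0) \<longrightarrow>
        (\<exists>e. cech_cochain M \<sigma> F V (p - 1) e \<and> (\<forall>A\<subseteq>F. coboundary e A = c A)))"

lemma cech_exactE:
  assumes "cech_exact M \<sigma> F V p" "cech_cochain M \<sigma> F V p c"
    and "\<forall>A\<subseteq>F. coboundary c A = 0"
  obtains e where "cech_cochain M \<sigma> F V (p - 1) e" "\<forall>A\<subseteq>F. coboundary e A = c A"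
  using assms unfolding cech_exact_def by blast

lemma coboundary_cong:
  assumes "\<And>B. B \<subseteq> A \<Longrightarrow> c B = c' B"
  shows "coboundary c A = coboundary c' A"
  unfolding coboundary_def by (intro sum.cong refl) (metis assms Diff_subset)

lemma coboundary_diff: "coboundary (\<lambda>A. c A - c' A) A = coboundary c A - coboundary c' A"
  by (simp add: coboundary_def right_diff_distrib sum_subtractf)

lemma coboundary_mult: "coboundary (\<lambda>A. r * c A) A = r * coboundary c A"
  by (simp add: coboundary_def sum_distrib_left mult.left_commute)

lemma sign_mult_self: "(-1 :: 'v::comm_ring_1) ^ k * ((-1) ^ k * x) = x"
  by (cases "even k") simp_all

lemma sign_mult_around: "(-1 :: 'v::comm_ring_1) ^ k * (x * ((-1) ^ k * y)) = x * y"
  by (cases "even k") simp_all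

definition below_sign :: "'g::linorder \<Rightarrow> 'g set \<Rightarrow> 'v::comm_ring_1" where
  "below_sign g A = (-1) ^ card {b\<in>A. b < g}"

lemma below_sign_self: "below_sign g A * (below_sign g A * x) = x"
  by (simp add: below_sign_def sign_mult_self)

text \<open>
  Splitting a cochain on \<open>insert g F\<close> into its values on sets without \<open>g\<close> and on sets with \<open>g\<close>, the
  differential becomes that of a mapping cone. The position of \<open>g\<close> in the order contributes a sign;
  absorbing \<open>below_sign\<close> into the second component makes the formula independent of the position.
\<close>

lemma coboundary_insert:
  fixes c :: "'g::{finite,linorder} set \<Rightarrow> 'v::comm_ring_1"
  assumes g: "g \<notin> A"
  shows "coboundary c (insert g A) =
           below_sign g A * (c A - coboundary (\<lambda>B. below_sign g B * c (insert g B)) A)"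
proof -
  have fin: "finite S" for S :: "'g set" by simp
  have pos_g: "{b \<in> insert g A. b < g} = {b\<in>A. b < g}" by auto
  have summand: "(-1) ^ card {b \<in> insert g A. b < a} * c (insert g A - {a}) =
      - (below_sign g A * ((-1) ^ card {b\<in>A. b < a} * (below_sign g (A - {a}) * c (insert g (A - {a})))))"
    if a: "a \<in> A" for a
  proof -
    have ne: "a \<noteq> g" using a g by auto
    have ins: "insert g A - {a} = insert g (A - {a})" using ne by auto
    show ?thesis
    proof (cases "a < g")
      case True
      have "{b \<in> insert g A. b < a} = {b\<in>A. b < a}" using True by auto
      moreover have "{b\<in>A. b < g} = insert a {b\<in>A - {a}. b < g}" using True a by auto
      then have "card {b\<in>A. b < g} = Suc (card {b\<in>A - {a}. b < g})" by (simp add: fin)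
      ultimately show ?thesis
        by (simp add: below_sign_def ins sign_mult_around)
    next
      case False
      then have ga: "g < a" using ne by auto
      have "{b \<in> insert g A. b < a} = insert g {b\<in>A. b < a}" using ga by auto
      then have "card {b \<in> insert g A. b < a} = Suc (card {b\<in>A. b < a})" using g by (simp add: fin)
      moreover have "{b\<in>A. b < g} = {b\<in>A - {a}. b < g}" using False by auto
      ultimately show ?thesis
        by (simp add: below_sign_def ins sign_mult_around)
    qed
  qed
  have "coboundary c (insert g A) = below_sign g A * c A
      + (\<Sum>a\<in>A. (-1) ^ card {b \<in> insert g A. b < a} * c (insert g A - {a}))"
    unfolding coboundary_def below_sign_def using g
    by (simp only: sum.insert[OF fin g] pos_g insert_Diff_if) simp
  also have "(\<Sum>a\<in>A. (-1) ^ card {b \<in> insert g A. b < a} * c (insert g A - {a})) =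
      - (below_sign g A * coboundary (\<lambda>B. below_sign g B * c (insert g B)) A)"
    unfolding coboundary_def sum_distrib_left sum_negf[symmetric] by (intro sum.cong refl summand)
  finally show ?thesis by (simp add: right_diff_distrib)
qed

text \<open>
  The cochain on \<open>insert g F\<close> whose two components in the above splitting are \<open>c\<^sub>0\<close> and \<open>c\<^sub>1\<close>.
\<close>

definition glue ::
  "'g::linorder \<Rightarrow> ('g set \<Rightarrow> 'v::comm_ring_1) \<Rightarrow> ('g set \<Rightarrow> 'v) \<Rightarrow> 'g set \<Rightarrow> 'v" where
  "glue g c\<^sub>0 c\<^sub>1 A = (if g \<in> A then below_sign g (A - {g}) * c\<^sub>1 (A - {g}) else c\<^sub>0 A)"

lemma coboundary_glue:
  fixes c\<^sub>0 :: "'g::{finite,linorder} set \<Rightarrow> 'v::comm_ring_1"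
  assumes "g \<notin> A"
  shows "coboundary (glue g c\<^sub>0 c\<^sub>1) A = coboundary c\<^sub>0 A"
    and "coboundary (glue g c\<^sub>0 c\<^sub>1) (insert g A) = below_sign g A * (c\<^sub>0 A - coboundary c\<^sub>1 A)"
proof -
  show "coboundary (glue g c\<^sub>0 c\<^sub>1) A = coboundary c\<^sub>0 A"
    using assms by (intro coboundary_cong) (auto simp: glue_def)
  have "coboundary (\<lambda>B. below_sign g B * glue g c\<^sub>0 c\<^sub>1 (insert g B)) A = coboundary c\<^sub>1 A"
  proof (intro coboundary_cong)
    fix B assume "B \<subseteq> A"
    then have "B - {g} = B" using assms by auto
    then show "below_sign g B * glue g c\<^sub>0 c\<^sub>1 (insert g B) = c\<^sub>1 B"
      by (simp add: glue_def below_sign_self)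
  qed
  then show "coboundary (glue g c\<^sub>0 c\<^sub>1) (insert g A) = below_sign g A * (c\<^sub>0 A - coboundary c\<^sub>1 A)"
    using assms by (simp add: coboundary_insert) (simp add: glue_def)
qed

lemma subset_insert_cases:
  assumes "A \<subseteq> insert g F"
  obtains "A \<subseteq> F" | B where "B \<subseteq> F" "g \<notin> B" "A = insert g B"
proof (cases "g \<in> A")
  case True
  show thesis
  proof (rule that(2))
    show "A - {g} \<subseteq> F" using assms by blast
    show "A = insert g (A - {g})" using True by blast
  qed simp
next
  case False
  then have "A \<subseteq> F" using assms by blast
  then show thesis by (rule that(1))
qed

text \<open>
  What the cone argument uses about the localizations of an ideal, or about their homogeneous
  components, inside the ring of Laurent polynomials.
\<close>

locale subgroup_system =
  fixes M :: "'w set \<Rightarrow> 'v::comm_ring_1 set"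
  assumes mono: "V \<subseteq> W \<Longrightarrow> M V \<subseteq> M W"
    and zero: "0 \<in> M V"
    and diff: "x \<in> M V \<Longrightarrow> y \<in> M V \<Longrightarrow> x - y \<in> M V"
begin

lemma uminus: "x \<in> M V \<Longrightarrow> - x \<in> M V"
  using diff[OF zero, of x V] by simp

lemma below_sign_mult: "x \<in> M V \<Longrightarrow> below_sign g A * x \<in> M V"
  by (cases "even (card {b\<in>A. b < g})") (simp_all add: below_sign_def uminus)

lemma cochain_link:
  fixes \<sigma> :: "'g::{finite,linorder} \<Rightarrow> 'w set"
  assumes c: "cech_cochain M \<sigma> (insert g F) V p c" and g: "g \<notin> F"
  shows "cech_cochain M \<sigma> F (V \<union> \<sigma> g) (p - 1) (\<lambda>A. below_sign g A * c (insert g A))"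
  unfolding cech_cochain_def
proof (intro allI impI conjI)
  fix A assume A: "A \<subseteq> F"
  then have "insert g A \<subseteq> insert g F" by auto
  then have cA: "c (insert g A) \<in> M (V \<union> \<Union>(\<sigma> ` insert g A))"
    "c (insert g A) \<noteq> 0 \<longrightarrow> int (card (insert g A)) = p"
    using c unfolding cech_cochain_def by blast+
  have "V \<union> \<Union>(\<sigma> ` insert g A) = V \<union> \<sigma> g \<union> \<Union>(\<sigma> ` A)" by auto
  with cA(1) show "below_sign g A * c (insert g A) \<in> M (V \<union> \<sigma> g \<union> \<Union>(\<sigma> ` A))"
    by (simp add: below_sign_mult)
  have "g \<notin> A" using A g by auto
  then show "int (card A) = p - 1" if "below_sign g A * c (insert g A) \<noteq> 0"
    using cA(2) that by auto
qed

lemma cochain_restrict: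
  "cech_cochain M \<sigma> F V p c \<Longrightarrow> F' \<subseteq> F \<Longrightarrow> cech_cochain M \<sigma> F' V p c"
  unfolding cech_cochain_def by blast

lemma cochain_localize:
  assumes "cech_cochain M \<sigma> F V p c" "V \<subseteq> W"
  shows "cech_cochain M \<sigma> F W p c"
proof -
  have "M (V \<union> \<Union>(\<sigma> ` A)) \<subseteq> M (W \<union> \<Union>(\<sigma> ` A))" for A
    using assms(2) by (intro mono) auto
  then show ?thesis using assms(1) unfolding cech_cochain_def by blast
qed

lemma cochain_diff:
  assumes "cech_cochain M \<sigma> F V p c" "cech_cochain M \<sigma> F V p c'"
  shows "cech_cochain M \<sigma> F V p (\<lambda>A. c A - c' A)"
  unfolding cech_cochain_def
proof (intro allI impI conjI)
  fix A assume A: "A \<subseteq> F"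
  show "c A - c' A \<in> M (V \<union> \<Union>(\<sigma> ` A))"
    using assms A by (auto simp: cech_cochain_def intro: diff)
  show "int (card A) = p" if "c A - c' A \<noteq> 0"
  proof -
    have "c A \<noteq> 0 \<or> c' A \<noteq> 0" using that by auto
    then show ?thesis using assms A by (auto simp: cech_cochain_def)
  qed
qed

lemma cochain_glue:
  fixes \<sigma> :: "'g::{finite,linorder} \<Rightarrow> 'w set"
  assumes c0: "cech_cochain M \<sigma> F V p c\<^sub>0" and c1: "cech_cochain M \<sigma> F (V \<union> \<sigma> g) (p - 1) c\<^sub>1"
    and g: "g \<notin> F"
  shows "cech_cochain M \<sigma> (insert g F) V p (glue g c\<^sub>0 c\<^sub>1)"
  unfolding cech_cochain_def
proof (intro allI impI)
  fix A assume "A \<subseteq> insert g F"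
  then show "glue g c\<^sub>0 c\<^sub>1 A \<in> M (V \<union> \<Union>(\<sigma> ` A)) \<and>
      (glue g c\<^sub>0 c\<^sub>1 A \<noteq> 0 \<longrightarrow> int (card A) = p)"
  proof (cases rule: subset_insert_cases)
    case 1
    then have "g \<notin> A" using g by auto
    then show ?thesis using c0 1 by (auto simp: cech_cochain_def glue_def)
  next
    case (2 B)
    have "V \<union> \<Union>(\<sigma> ` A) = V \<union> \<sigma> g \<union> \<Union>(\<sigma> ` B)" using 2 by auto
    moreover have "glue g c\<^sub>0 c\<^sub>1 A = below_sign g B * c\<^sub>1 B" using 2 by (simp add: glue_def)
    ultimately show ?thesis
      using c1 2 by (auto simp: cech_cochain_def below_sign_mult)
  qed
qed

text \<open>
  One half of the long exact sequence of the cone. A cocycle is a pair \<open>(c\<^sub>0, c\<^sub>1)\<close> with \<open>c\<^sub>0\<close> a cocycle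
  on \<open>F\<close> and \<open>\<delta> c\<^sub>1 = c\<^sub>0\<close> after inverting \<open>g\<close>. Given \<open>\<delta> e\<^sub>0 = c\<^sub>0\<close>, the difference \<open>e\<^sub>0 - c\<^sub>1\<close> is a cocycle
  in the exact localized complex, and a primitive of it completes \<open>e\<^sub>0\<close> to a primitive of the pair.
\<close>

lemma exact_insert:
  fixes \<sigma> :: "'g::{finite,linorder} \<Rightarrow> 'w set"
  assumes acyclic: "\<And>q. cech_exact M \<sigma> F (V \<union> \<sigma> g) q" and ex: "cech_exact M \<sigma> F V p"
  shows "cech_exact M \<sigma> (insert g F) V p"
proof (cases "g \<in> F")
  case True
  with ex show ?thesis by (simp add: insert_absorb)
next
  case g: False
  show ?thesis
    unfolding cech_exact_def
  proof (intro allI impI, elim conjE)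
    fix c assume c: "cech_cochain M \<sigma> (insert g F) V p c"
      and cocycle: "\<forall>A\<subseteq>insert g F. coboundary c A = 0"
    define c\<^sub>1 where "c\<^sub>1 = (\<lambda>A. below_sign g A * c (insert g A))"
    have c1: "cech_cochain M \<sigma> F (V \<union> \<sigma> g) (p - 1) c\<^sub>1"
      unfolding c\<^sub>1_def by (rule cochain_link[OF c g])
    have dc: "\<forall>A\<subseteq>F. coboundary c A = 0" using cocycle by (simp add: subset_insertI2)
    obtain e\<^sub>0 where e0: "cech_cochain M \<sigma> F V (p - 1) e\<^sub>0" "\<forall>A\<subseteq>F. coboundary e\<^sub>0 A = c A"
      by (rule cech_exactE[OF ex cochain_restrict[OF c subset_insertI] dc])
    have dc1: "coboundary c\<^sub>1 A = c A" if A: "A \<subseteq> F" for A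
    proof -
      have "g \<notin> A" "insert g A \<subseteq> insert g F" using A g by auto
      then have "below_sign g A * (c A - coboundary c\<^sub>1 A) = 0"
        using cocycle coboundary_insert[of g A c] unfolding c\<^sub>1_def by auto
      then show ?thesis by (metis below_sign_self eq_iff_diff_eq_0 mult_zero_right)
    qed
    have "cech_cochain M \<sigma> F (V \<union> \<sigma> g) (p - 1) (\<lambda>A. e\<^sub>0 A - c\<^sub>1 A)"
      by (intro cochain_diff c1 cochain_localize[OF e0(1)]) auto
    moreover have "\<forall>A\<subseteq>F. coboundary (\<lambda>A. e\<^sub>0 A - c\<^sub>1 A) A = 0"
      by (simp add: coboundary_diff dc1 e0(2))
    ultimately obtain e\<^sub>1 where e1: "cech_cochain M \<sigma> F (V \<union> \<sigma> g) (p - 1 - 1) e\<^sub>1"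
      "\<forall>A\<subseteq>F. coboundary e\<^sub>1 A = e\<^sub>0 A - c\<^sub>1 A"
      by (rule cech_exactE[OF acyclic])
    have "coboundary (glue g e\<^sub>0 e\<^sub>1) A = c A" if "A \<subseteq> insert g F" for A
      using that
    proof (cases rule: subset_insert_cases)
      case 1
      then have "g \<notin> A" using g by auto
      then show ?thesis using 1 by (simp add: coboundary_glue e0(2))
    next
      case (2 B)
      then show ?thesis by (simp add: coboundary_glue e1(2) c\<^sub>1_def below_sign_self)
    qed
    then show "\<exists>e. cech_cochain M \<sigma> (insert g F) V (p - 1) e \<and> (\<forall>A\<subseteq>insert g F. coboundary e A = c A)"
      using cochain_glue[OF e0(1) e1(1) g] by blast
  qed
qed

text \<open>
  The other half: a cocycle \<open>c\<close> on \<open>F\<close> extends to a cocycle \<open>(c, c\<^sub>1)\<close> on \<open>insert g F\<close>, because \<open>c\<close>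
  becomes a coboundary \<open>\<delta> c\<^sub>1\<close> after inverting \<open>g\<close>. A primitive of the pair restricts to one of \<open>c\<close>.
\<close>

lemma exact_remove:
  fixes \<sigma> :: "'g::{finite,linorder} \<Rightarrow> 'w set"
  assumes acyclic: "\<And>q. cech_exact M \<sigma> F (V \<union> \<sigma> g) q"
    and ex: "cech_exact M \<sigma> (insert g F) V p"
  shows "cech_exact M \<sigma> F V p"
proof (cases "g \<in> F")
  case True
  with ex show ?thesis by (simp add: insert_absorb)
next
  case g: False
  show ?thesis
    unfolding cech_exact_def
  proof (intro allI impI, elim conjE)
    fix c assume c: "cech_cochain M \<sigma> F V p c" and cocycle: "\<forall>A\<subseteq>F. coboundary c A = 0"
    have "cech_cochain M \<sigma> F (V \<union> \<sigma> g) p c" by (rule cochain_localize[OF c]) simp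
    then obtain c\<^sub>1 where c1: "cech_cochain M \<sigma> F (V \<union> \<sigma> g) (p - 1) c\<^sub>1"
      "\<forall>A\<subseteq>F. coboundary c\<^sub>1 A = c A"
      using cocycle by (rule cech_exactE[OF acyclic])
    have closed: "coboundary (glue g c c\<^sub>1) A = 0" if "A \<subseteq> insert g F" for A
      using that
    proof (cases rule: subset_insert_cases)
      case 1
      then have "g \<notin> A" using g by auto
      then show ?thesis using 1 cocycle by (simp add: coboundary_glue)
    next
      case (2 B)
      then show ?thesis by (simp add: coboundary_glue c1(2))
    qed
    obtain e where e: "cech_cochain M \<sigma> (insert g F) V (p - 1) e"
      "\<forall>A\<subseteq>insert g F. coboundary e A = glue g c c\<^sub>1 A"
      by (rule cech_exactE[OF ex cochain_glue[OF c c1(1) g]]) (simp add: closed)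
    have "coboundary e A = c A" if "A \<subseteq> F" for A
    proof -
      have "g \<notin> A" "A \<subseteq> insert g F" using that g by auto
      then show ?thesis using e(2) by (simp add: glue_def)
    qed
    then show "\<exists>e. cech_cochain M \<sigma> F V (p - 1) e \<and> (\<forall>A\<subseteq>F. coboundary e A = c A)"
      using cochain_restrict[OF e(1) subset_insertI] by blast
  qed
qed

text \<open>
  If the generator \<open>g\<close> is already invertible, inserting \<open>g\<close> into the index sets is a contracting
  homotopy.
\<close>

lemma exact_if_unit:
  fixes \<sigma> :: "'g::{finite,linorder} \<Rightarrow> 'w set"
  assumes "g \<in> F" "\<sigma> g \<subseteq> V"
  shows "cech_exact M \<sigma> F V p"
  unfolding cech_exact_def
proof (intro allI impI, elim conjE)
  fix c assume c: "cech_cochain M \<sigma> F V p c" and cocycle: "\<forall>A\<subseteq>F. coboundary c A = 0"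
  define G where "G = F - {g}"
  have F: "F = insert g G" and g: "g \<notin> G" using assms(1) by (auto simp: G_def)
  define c\<^sub>1 where "c\<^sub>1 = (\<lambda>A. below_sign g A * c (insert g A))"
  have V: "V \<union> \<sigma> g = V" using assms(2) by auto
  have c1: "cech_cochain M \<sigma> G V (p - 1) c\<^sub>1"
    using cochain_link[OF c[unfolded F] g] unfolding c\<^sub>1_def V .
  have dc1: "coboundary c\<^sub>1 A = c A" if A: "A \<subseteq> G" for A
  proof -
    have "g \<notin> A" "insert g A \<subseteq> F" using A g F by auto
    then have "below_sign g A * (c A - coboundary c\<^sub>1 A) = 0"
      using cocycle coboundary_insert[of g A c] unfolding c\<^sub>1_def by auto
    then show ?thesis by (metis below_sign_self eq_iff_diff_eq_0 mult_zero_right)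
  qed
  have "cech_cochain M \<sigma> G (V \<union> \<sigma> g) (p - 1 - 1) (\<lambda>_. 0)"
    by (simp add: cech_cochain_def zero)
  from cochain_glue[OF c1 this g] have e: "cech_cochain M \<sigma> F V (p - 1) (glue g c\<^sub>1 (\<lambda>_. 0))"
    by (simp add: F)
  have "coboundary (glue g c\<^sub>1 (\<lambda>_. 0)) A = c A" if "A \<subseteq> F" for A
    using that unfolding F
  proof (cases rule: subset_insert_cases)
    case 1
    then have "g \<notin> A" using g by auto
    then show ?thesis using 1 by (simp add: coboundary_glue dc1)
  next
    case (2 B)
    have "coboundary (\<lambda>_. 0 :: 'v) B = 0" by (simp add: coboundary_def)
    then show ?thesis using 2 by (simp add: coboundary_glue c\<^sub>1_def below_sign_self)
  qed
  with e show "\<exists>e. cech_cochain M \<sigma> F V (p - 1) e \<and> (\<forall>A\<subseteq>F. coboundary e A = c A)"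
    by blast
qed

text \<open>
  Adding the generators of \<open>G\<close> one after the other. Each step needs exactness for the family reached so
  far over the localization at the next generator. The class \<open>P\<close> of sets of inverted variables is
  stable under further localization, so that exactness over all its members is preserved in the
  induction along with exactness over \<open>V\<close> itself.
\<close>

lemma exact_union:
  fixes \<sigma> :: "'g::{finite,linorder} \<Rightarrow> 'w set"
  assumes acyclic: "\<And>U q. P U \<Longrightarrow> cech_exact M \<sigma> F U q"
    and step: "\<And>U g. g \<in> G \<Longrightarrow> P U \<Longrightarrow> P (U \<union> \<sigma> g)"
    and start: "\<And>g. g \<in> G \<Longrightarrow> P (V \<union> \<sigma> g)"
    and ex: "cech_exact M \<sigma> F V p"
  shows "cech_exact M \<sigma> (G \<union> F) V p"
proof -
  have "(\<forall>U q. P U \<longrightarrow> cech_exact M \<sigma> (H \<union> F) U q) \<and> cech_exact M \<sigma> (H \<union> F) V p"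
    if "finite H" "H \<subseteq> G" for H
    using that
  proof (induction H rule: finite_induct)
    case empty
    then show ?case using acyclic ex by simp
  next
    case (insert g H)
    then have g: "g \<in> G" by simp
    have *: "\<And>U q. P U \<Longrightarrow> cech_exact M \<sigma> (H \<union> F) U q" "cech_exact M \<sigma> (H \<union> F) V p"
      using insert by auto
    then show ?case
      using step[OF g] start[OF g] by (auto intro!: exact_insert)
  qed
  from this[of G] show ?thesis by simp
qed

text \<open>
  Generators that are multiples of others contribute nothing to the radical of the ideal, hence
  nothing to the cohomology.
\<close>

lemma exact_remove_multiples:
  fixes \<sigma> :: "'g::{finite,linorder} \<Rightarrow> 'w set"
  assumes multiple: "\<And>g. g \<in> G \<Longrightarrow> \<exists>a\<in>F. \<sigma> a \<subseteq> \<sigma> g"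
    and ex: "cech_exact M \<sigma> (G \<union> F) V p"
  shows "cech_exact M \<sigma> F V p"
proof -
  have "cech_exact M \<sigma> (H \<union> F) V p \<longrightarrow> cech_exact M \<sigma> F V p" if "finite H" "H \<subseteq> G" for H
    using that
  proof (induction H rule: finite_induct)
    case (insert g H)
    then obtain a where "a \<in> F" "\<sigma> a \<subseteq> \<sigma> g" using multiple[of g] by auto
    then have "cech_exact M \<sigma> (H \<union> F) (V \<union> \<sigma> g) q" for q
      by (intro exact_if_unit[of a]) auto
    then have "cech_exact M \<sigma> (insert g (H \<union> F)) V p \<Longrightarrow> cech_exact M \<sigma> (H \<union> F) V p"
      by (rule exact_remove)
    then show ?case using insert by simp
  qed simp
  from this[of G] show ?thesis using ex by simp
qed

end

lemma coboundary_image: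
  fixes \<iota> :: "'g::linorder \<Rightarrow> 'h::linorder"
  assumes "strict_mono \<iota>"
  shows "coboundary c (\<iota> ` A) = coboundary (\<lambda>B. c (\<iota> ` B)) A"
proof -
  have inj: "inj \<iota>" using assms by (rule strict_mono_imp_inj_on)
  have "{b \<in> \<iota> ` A. b < \<iota> a} = \<iota> ` {b\<in>A. b < a}" for a
    using strict_mono_less[OF assms] by auto
  then have "card {b \<in> \<iota> ` A. b < \<iota> a} = card {b\<in>A. b < a}" for a
    by (simp add: card_image inj_on_subset[OF inj])
  moreover have "\<iota> ` A - {\<iota> a} = \<iota> ` (A - {a})" for a
    using inj by (auto simp: inj_def)
  ultimately show ?thesis
    unfolding coboundary_def by (simp add: sum.reindex inj_on_subset[OF inj])
qed

text \<open>
  Two Cech complexes with different index types are compared by embedding both index types into a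
  third one. Monotonicity of the embedding preserves the signs.
\<close>

lemma cech_exact_range:
  fixes \<iota> :: "'g::linorder \<Rightarrow> 'h::linorder" and M :: "'w set \<Rightarrow> 'v::comm_ring_1 set"
  assumes \<iota>: "strict_mono \<iota>"
  shows "cech_exact M \<sigma> (range \<iota>) V p \<longleftrightarrow> cech_exact M (\<sigma> \<circ> \<iota>) UNIV V p"
proof -
  have inj: "inj \<iota>" using \<iota> by (rule strict_mono_imp_inj_on)
  have sub: "(\<forall>A\<subseteq>range \<iota>. P A) \<longleftrightarrow> (\<forall>A. P (\<iota> ` A))" for P
    by (auto simp: subset_image_iff)
  have card: "card (\<iota> ` A) = card A" for A
    by (simp add: card_image inj_on_subset[OF inj])
  have cochain: "cech_cochain M \<sigma> (range \<iota>) V q c \<longleftrightarrow>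
      cech_cochain M (\<sigma> \<circ> \<iota>) UNIV V q (\<lambda>A. c (\<iota> ` A))" for q c
    unfolding cech_cochain_def sub by (simp add: card image_image)
  have surj: "\<exists>c. c' = (\<lambda>A. c (\<iota> ` A))" for c' :: "'g set \<Rightarrow> 'v"
    by (rule exI[of _ "\<lambda>T. c' (\<iota> -` T)"]) (simp add: inj_vimage_image_eq[OF inj])
  show ?thesis
    unfolding cech_exact_def sub cochain coboundary_image[OF \<iota>]
  proof (intro iffI allI impI; elim conjE)
    fix c' :: "'g set \<Rightarrow> 'v"
    assume L: "\<forall>c. cech_cochain M (\<sigma> \<circ> \<iota>) UNIV V p (\<lambda>A. c (\<iota> ` A)) \<and>
        (\<forall>A. coboundary (\<lambda>B. c (\<iota> ` B)) A = 0) \<longrightarrow>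
        (\<exists>e. cech_cochain M (\<sigma> \<circ> \<iota>) UNIV V (p - 1) (\<lambda>A. e (\<iota> ` A)) \<and>
             (\<forall>A. coboundary (\<lambda>B. e (\<iota> ` B)) A = c (\<iota> ` A)))"
      and c': "cech_cochain M (\<sigma> \<circ> \<iota>) UNIV V p c'" "\<forall>A\<subseteq>UNIV. coboundary c' A = 0"
    obtain c where "c' = (\<lambda>A. c (\<iota> ` A))" using surj by blast
    with L c' show "\<exists>e. cech_cochain M (\<sigma> \<circ> \<iota>) UNIV V (p - 1) e \<and> (\<forall>A\<subseteq>UNIV. coboundary e A = c' A)"
      by fastforce
  next
    fix c :: "'h set \<Rightarrow> 'v"
    assume R: "\<forall>c. cech_cochain M (\<sigma> \<circ> \<iota>) UNIV V p c \<and> (\<forall>A\<subseteq>UNIV. coboundary c A = 0) \<longrightarrow>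
        (\<exists>e. cech_cochain M (\<sigma> \<circ> \<iota>) UNIV V (p - 1) e \<and> (\<forall>A\<subseteq>UNIV. coboundary e A = c A))"
      and c: "cech_cochain M (\<sigma> \<circ> \<iota>) UNIV V p (\<lambda>A. c (\<iota> ` A))"
        "\<forall>A. coboundary (\<lambda>B. c (\<iota> ` B)) A = 0"
    then obtain e' where "cech_cochain M (\<sigma> \<circ> \<iota>) UNIV V (p - 1) e'" "\<And>A. coboundary e' A = c (\<iota> ` A)"
      by (metis subset_UNIV)
    moreover obtain e where "e' = (\<lambda>A. e (\<iota> ` A))" using surj by blast
    ultimately show "\<exists>e. cech_cochain M (\<sigma> \<circ> \<iota>) UNIV V (p - 1) (\<lambda>A. e (\<iota> ` A)) \<and>
        (\<forall>A. coboundary (\<lambda>B. e (\<iota> ` B)) A = c (\<iota> ` A))"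
      by auto
  qed
qed

section \<open>Localizations of a bihomogeneous ideal\<close>

lemma poly_mapping_sum_singles:
  "(\<Sum>t\<in>Poly_Mapping.keys p. Poly_Mapping.single t (Poly_Mapping.lookup p t)) = p"
  by (rule poly_mapping_eqI)
     (auto simp: lookup_sum lookup_single when_def in_keys_iff)

lemma poly_mapping_add_induct [case_names single add]:
  fixes p :: "'a \<Rightarrow>\<^sub>0 'b::comm_monoid_add"
  assumes single: "\<And>t c. P (Poly_Mapping.single t c)"
    and add: "\<And>p q. P p \<Longrightarrow> P q \<Longrightarrow> P (p + q)"
  shows "P p"
proof -
  have "P (\<Sum>t\<in>T. Poly_Mapping.single t (Poly_Mapping.lookup p t))" if "finite T" for T
    using that
  proof (induction T rule: finite_induct)
    case empty
    show ?case using single[of undefined 0] by simp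
  next
    case (insert t T)
    then show ?case using single add by simp
  qed
  from this[of "Poly_Mapping.keys p"] show ?thesis by (simp add: poly_mapping_sum_singles)
qed

lemma lookup_monomial_mult:
  fixes h :: "'a::ab_group_add \<Rightarrow>\<^sub>0 'k::comm_ring_1"
  shows "Poly_Mapping.lookup (Poly_Mapping.single t c * h) u = c * Poly_Mapping.lookup h (u - t)"
proof (induction h rule: poly_mapping_add_induct)
  case (single s d)
  have "t + s = u \<longleftrightarrow> s = u - t" by (auto simp: algebra_simps)
  then show ?case by (simp add: mult_single lookup_single when_def)
next
  case (add p q)
  then show ?case by (simp add: distrib_left lookup_add)
qed

lemma monomial_mult_cancel:
  fixes h :: "'a::ab_group_add \<Rightarrow>\<^sub>0 'k::comm_ring_1"
  shows "Poly_Mapping.single (- t) 1 * (Poly_Mapping.single t 1 * h) = h"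
    and "Poly_Mapping.single t 1 * (Poly_Mapping.single (- t) 1 * h) = h"
  by (simp_all add: mult.assoc[symmetric] mult_single)

lemma monomial_mult_mult:
  fixes h :: "'a::comm_monoid_add \<Rightarrow>\<^sub>0 'k::comm_ring_1"
  shows "Poly_Mapping.single s 1 * (Poly_Mapping.single t 1 * h) = Poly_Mapping.single (s + t) 1 * h"
  by (simp add: mult.assoc[symmetric] mult_single)

abbreviation integral_exponent :: "('v \<Rightarrow>\<^sub>0 nat) \<Rightarrow> ('v \<Rightarrow>\<^sub>0 int)" where
  "integral_exponent \<equiv> Poly_Mapping.map int"

lemma lookup_integral_exponent [simp]:
  "Poly_Mapping.lookup (integral_exponent t) v = int (Poly_Mapping.lookup t v)"
  by (simp add: Poly_Mapping.map.rep_eq when_def)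

lemma integral_exponent_add: "integral_exponent (s + t) = integral_exponent s + integral_exponent t"
  by (rule poly_mapping_eqI) (simp add: lookup_add)

lemma integral_exponent_inject: "integral_exponent s = integral_exponent t \<longleftrightarrow> s = t"
proof
  assume *: "integral_exponent s = integral_exponent t"
  show "s = t"
  proof (rule poly_mapping_eqI)
    fix v
    show "Poly_Mapping.lookup s v = Poly_Mapping.lookup t v"
      using arg_cong[OF *, of "\<lambda>u. Poly_Mapping.lookup u v"] by simp
  qed
qed simp

lemma nonneg_exponentE:
  assumes "\<And>v. 0 \<le> Poly_Mapping.lookup t v"
  obtains s where "t = integral_exponent s"
proof
  show "t = integral_exponent (Poly_Mapping.map nat t)"
    using assms by (intro poly_mapping_eqI) (auto simp: Poly_Mapping.map.rep_eq when_def order.antisym)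
qed

lemma to_laurent_superset:
  assumes "finite T" "Poly_Mapping.keys p \<subseteq> T"
  shows "to_laurent p =
    (\<Sum>t\<in>T. Poly_Mapping.single (integral_exponent t) (Poly_Mapping.lookup p t))"
  unfolding to_laurent_def using assms
  by (intro sum.mono_neutral_left) (auto simp: in_keys_iff)

lemma to_laurent_add: "to_laurent (p + q) = to_laurent p + to_laurent q"
proof -
  let ?T = "Poly_Mapping.keys p \<union> Poly_Mapping.keys q"
  have "Poly_Mapping.keys (p + q) \<subseteq> ?T" by (rule keys_add)
  then show ?thesis
    by (simp add: to_laurent_superset[of ?T] lookup_add single_add sum.distrib)
qed

lemma to_laurent_zero [simp]: "to_laurent 0 = 0"
  by (simp add: to_laurent_def)

lemma to_laurent_diff: "to_laurent (p - q) = to_laurent p - to_laurent q"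
  using to_laurent_add[of "p - q" q] by simp

lemma to_laurent_single: "to_laurent (Poly_Mapping.single t c) = Poly_Mapping.single (integral_exponent t) c"
  by (simp add: to_laurent_superset[of "{t}"])

lemma to_laurent_monomial_mult:
  "to_laurent (Poly_Mapping.single t c * p) = Poly_Mapping.single (integral_exponent t) c * to_laurent p"
proof (induction p rule: poly_mapping_add_induct)
  case (single s d)
  then show ?case by (simp add: mult_single to_laurent_single integral_exponent_add)
next
  case (add p q)
  then show ?case by (simp add: distrib_left to_laurent_add)
qed

lemma lookup_to_laurent:
  "Poly_Mapping.lookup (to_laurent p) (integral_exponent t) = Poly_Mapping.lookup p t"
proof (induction p rule: poly_mapping_add_induct)
  case (single s d)
  then show ?case by (simp add: to_laurent_single lookup_single integral_exponent_inject)
next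
  case (add p q)
  then show ?case by (simp add: to_laurent_add lookup_add)
qed

lemma lookup_to_laurent_nonzeroE:
  assumes "Poly_Mapping.lookup (to_laurent p) t \<noteq> 0"
  obtains s where "s \<in> Poly_Mapping.keys p" "t = integral_exponent s"
proof -
  have "(\<Sum>s\<in>Poly_Mapping.keys p. Poly_Mapping.lookup
      (Poly_Mapping.single (integral_exponent s) (Poly_Mapping.lookup p s)) t) \<noteq> 0"
    using assms by (simp add: to_laurent_def lookup_sum)
  then obtain s where "s \<in> Poly_Mapping.keys p"
    "Poly_Mapping.lookup (Poly_Mapping.single (integral_exponent s) (Poly_Mapping.lookup p s)) t \<noteq> 0"
    by (rule sum.not_neutral_contains_not_neutral)
  then show ?thesis using that by (auto simp: lookup_single when_def split: if_splits)
qed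

lemma module_times: "module ((*) :: 'r::comm_ring_1 \<Rightarrow> 'r \<Rightarrow> 'r)"
  by unfold_locales (simp_all add: algebra_simps)

lemma bihomogeneous_ideal_closed:
  assumes "bihomogeneous_ideal I"
  shows "0 \<in> I" "f \<in> I \<Longrightarrow> g \<in> I \<Longrightarrow> f + g \<in> I" "f \<in> I \<Longrightarrow> g \<in> I \<Longrightarrow> f - g \<in> I" "f \<in> I \<Longrightarrow> r * f \<in> I"
proof -
  obtain B where I: "I = module.span (*) B" using assms unfolding bihomogeneous_ideal_def by blast
  interpret module "(*) :: ('a, 'b, 'c) bipoly \<Rightarrow> _" by (rule module_times)
  show "0 \<in> I" "f \<in> I \<Longrightarrow> g \<in> I \<Longrightarrow> f + g \<in> I" "f \<in> I \<Longrightarrow> g \<in> I \<Longrightarrow> f - g \<in> I" "f \<in> I \<Longrightarrow> r * f \<in> I"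
    unfolding I by (auto intro: span_zero span_add span_diff span_scale)
qed

text \<open>
  The localization of \<open>I\<close> at all variables in \<open>V\<close>, as a set of Laurent polynomials: those that are
  carried into \<open>I\<close> by some monomial in these variables.
\<close>

definition localized_at ::
  "('n, 'm, 'k::comm_ring_1) bipoly set \<Rightarrow> ('n + 'm) set \<Rightarrow> ('n, 'm, 'k) bilaurent set" where
  "localized_at I V = {h. \<exists>t. (\<forall>v. 0 \<le> Poly_Mapping.lookup t v) \<and> Poly_Mapping.keys t \<subseteq> V \<and>
     Poly_Mapping.single t 1 * h \<in> to_laurent ` I}"

lemma localized_at_mono: "V \<subseteq> W \<Longrightarrow> localized_at I V \<subseteq> localized_at I W"
  unfolding localized_at_def by blast

lemma to_laurent_image_closed:
  assumes I: "bihomogeneous_ideal I"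
  shows "h \<in> to_laurent ` I \<Longrightarrow> k \<in> to_laurent ` I \<Longrightarrow> h + k \<in> to_laurent ` I"
    "h \<in> to_laurent ` I \<Longrightarrow> k \<in> to_laurent ` I \<Longrightarrow> h - k \<in> to_laurent ` I"
    "(\<And>v. 0 \<le> Poly_Mapping.lookup t v) \<Longrightarrow> h \<in> to_laurent ` I \<Longrightarrow> Poly_Mapping.single t 1 * h \<in> to_laurent ` I"
proof -
  note closed = bihomogeneous_ideal_closed[OF I]
  show "h \<in> to_laurent ` I \<Longrightarrow> k \<in> to_laurent ` I \<Longrightarrow> h + k \<in> to_laurent ` I"
    using closed(2) to_laurent_add by (metis (no_types, lifting) image_iff)
  show "h \<in> to_laurent ` I \<Longrightarrow> k \<in> to_laurent ` I \<Longrightarrow> h - k \<in> to_laurent ` I"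
    using closed(3) to_laurent_diff by (metis (no_types, lifting) image_iff)
  assume "\<And>v. 0 \<le> Poly_Mapping.lookup t v" "h \<in> to_laurent ` I"
  then obtain s f where "t = integral_exponent s" "f \<in> I" "h = to_laurent f"
    by (metis imageE nonneg_exponentE)
  then show "Poly_Mapping.single t 1 * h \<in> to_laurent ` I"
    using closed(4)[of f "Poly_Mapping.single s 1"] by (metis imageI to_laurent_monomial_mult)
qed

lemma localized_at_zero: "bihomogeneous_ideal I \<Longrightarrow> 0 \<in> localized_at I V"
  unfolding localized_at_def using bihomogeneous_ideal_closed(1)[of I]
  by (auto intro!: exI[of _ 0] image_eqI[of _ _ 0])

lemma localized_at_diff:
  assumes I: "bihomogeneous_ideal I" and h: "h \<in> localized_at I V" "k \<in> localized_at I V"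
  shows "h - k \<in> localized_at I V"
proof -
  obtain s t where s: "\<And>v. 0 \<le> Poly_Mapping.lookup s v" "Poly_Mapping.keys s \<subseteq> V"
      "Poly_Mapping.single s 1 * h \<in> to_laurent ` I"
    and t: "\<And>v. 0 \<le> Poly_Mapping.lookup t v" "Poly_Mapping.keys t \<subseteq> V"
      "Poly_Mapping.single t 1 * k \<in> to_laurent ` I"
    using h unfolding localized_at_def by blast
  have "Poly_Mapping.single (s + t) 1 * (h - k) =
      Poly_Mapping.single t 1 * (Poly_Mapping.single s 1 * h) -
      Poly_Mapping.single s 1 * (Poly_Mapping.single t 1 * k)"
    by (simp add: monomial_mult_mult right_diff_distrib add.commute)
  also have "\<dots> \<in> to_laurent ` I"
    by (intro to_laurent_image_closed[OF I] s t)
  finally have "Poly_Mapping.single (s + t) 1 * (h - k) \<in> to_laurent ` I" .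
  moreover have "Poly_Mapping.keys (s + t) \<subseteq> V" using keys_add[of s t] s(2) t(2) by auto
  ultimately show ?thesis
    unfolding localized_at_def using s(1) t(1) by (auto simp: lookup_add intro!: exI[of _ "s + t"])
qed

lemma localized_at_empty: "localized_at I {} = to_laurent ` I"
proof -
  have "Poly_Mapping.keys t \<subseteq> {} \<longleftrightarrow> t = 0" for t :: "('a + 'b) \<Rightarrow>\<^sub>0 int" by simp
  then show ?thesis unfolding localized_at_def by (auto simp del: subset_empty)
qed

lemma localized_at_denominator:
  assumes u: "\<And>v. 0 \<le> Poly_Mapping.lookup u v" and h: "h \<in> localized_at I W"
  shows "Poly_Mapping.single (- u) 1 * h \<in> localized_at I (Poly_Mapping.keys u \<union> W)"
proof -
  obtain t where t: "\<And>v. 0 \<le> Poly_Mapping.lookup t v" "Poly_Mapping.keys t \<subseteq> W"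
    "Poly_Mapping.single t 1 * h \<in> to_laurent ` I"
    using h unfolding localized_at_def by blast
  have "Poly_Mapping.single (t + u) 1 * (Poly_Mapping.single (- u) 1 * h) = Poly_Mapping.single t 1 * h"
    by (simp add: monomial_mult_mult)
  moreover have "Poly_Mapping.keys (t + u) \<subseteq> Poly_Mapping.keys u \<union> W"
    using keys_add[of t u] t(2) by auto
  ultimately show ?thesis
    unfolding localized_at_def using t u by (auto simp: lookup_add intro!: exI[of _ "t + u"])
qed

text \<open>
  The multiplier is any sufficiently high power of one fixed monomial \<open>u\<close>, so that the finitely many
  values of a cochain can be freed of their denominators simultaneously. Denominators in the
  remaining variables of \<open>W\<close> are kept.
\<close>

lemma localized_at_clear_denominator:
  assumes I: "bihomogeneous_ideal I" and u: "\<And>v. 0 \<le> Poly_Mapping.lookup u v"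
    and h: "h \<in> localized_at I (Poly_Mapping.keys u \<union> W)"
  shows "\<exists>N\<^sub>0. \<forall>N\<ge>N\<^sub>0. Poly_Mapping.single (frag_cmul (int N) u) 1 * h \<in> localized_at I W"
proof -
  obtain t where t: "\<And>v. 0 \<le> Poly_Mapping.lookup t v" "Poly_Mapping.keys t \<subseteq> Poly_Mapping.keys u \<union> W"
    "Poly_Mapping.single t 1 * h \<in> to_laurent ` I"
    using h unfolding localized_at_def by blast
  define N\<^sub>0 where "N\<^sub>0 = (\<Sum>v\<in>Poly_Mapping.keys t. nat (Poly_Mapping.lookup t v))"
  have N0: "Poly_Mapping.lookup t v \<le> int N\<^sub>0" for v
  proof (cases "v \<in> Poly_Mapping.keys t")
    case True
    then have "nat (Poly_Mapping.lookup t v) \<le> N\<^sub>0" unfolding N\<^sub>0_def by (intro member_le_sum) auto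
    then show ?thesis by linarith
  qed (simp add: in_keys_iff)
  \<comment> \<open>The part of the denominator of \<open>h\<close> that the power of \<open>u\<close> does not absorb.\<close>
  define w where "w = Poly_Mapping.mapp (\<lambda>v k. if v \<in> Poly_Mapping.keys u then 0 else k) t"
  have w: "Poly_Mapping.lookup w v = (if v \<in> Poly_Mapping.keys u then 0 else Poly_Mapping.lookup t v)" for v
    by (auto simp: w_def lookup_mapp when_def in_keys_iff)
  show ?thesis
  proof (intro exI[of _ N\<^sub>0] allI impI)
    fix N assume N: "N\<^sub>0 \<le> N"
    define r where "r = w + frag_cmul (int N) u - t"
    have r: "0 \<le> Poly_Mapping.lookup r v" for v
    proof (cases "v \<in> Poly_Mapping.keys u")
      case True
      then have "1 \<le> Poly_Mapping.lookup u v" using u[of v] by (simp add: in_keys_iff)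
      then have "int N * 1 \<le> int N * Poly_Mapping.lookup u v" by (intro mult_left_mono) auto
      then have "Poly_Mapping.lookup t v \<le> int N * Poly_Mapping.lookup u v"
        using N0[of v] N by linarith
      then show ?thesis using True by (simp add: r_def w lookup_add lookup_minus)
    next
      case False
      then show ?thesis using u[of v] by (simp add: r_def w lookup_add lookup_minus)
    qed
    have "Poly_Mapping.single w 1 * (Poly_Mapping.single (frag_cmul (int N) u) 1 * h) =
        Poly_Mapping.single r 1 * (Poly_Mapping.single t 1 * h)"
      by (simp add: monomial_mult_mult r_def)
    also have "\<dots> \<in> to_laurent ` I" by (intro to_laurent_image_closed[OF I] r t)
    finally have "Poly_Mapping.single w 1 * (Poly_Mapping.single (frag_cmul (int N) u) 1 * h) \<in> to_laurent ` I" .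
    moreover have "Poly_Mapping.keys w \<subseteq> W"
    proof
      fix v assume "v \<in> Poly_Mapping.keys w"
      then have "v \<notin> Poly_Mapping.keys u" "v \<in> Poly_Mapping.keys t"
        using w[of v] by (auto simp: in_keys_iff split: if_splits)
      then show "v \<in> W" using t(2) by auto
    qed
    moreover have "0 \<le> Poly_Mapping.lookup w v" for v using t(1) by (simp add: w)
    ultimately show "Poly_Mapping.single (frag_cmul (int N) u) 1 * h \<in> localized_at I W"
      unfolding localized_at_def by blast
  qed
qed

lemma monomial_power:
  "Poly_Mapping.single u (1::'k::comm_ring_1) ^ k = Poly_Mapping.single (frag_cmul (int k) u) 1"
proof (induction k)
  case (Suc k)
  have "u + frag_cmul (int k) u = frag_cmul (int (Suc k)) u"
    by (rule poly_mapping_eqI) (simp add: lookup_add algebra_simps)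
  with Suc show ?case by (simp add: mult_single)
qed simp

lemma inverse_monomial_power:
  "Poly_Mapping.single (- u) (1::'k::comm_ring_1) ^ k = Poly_Mapping.single (frag_cmul (- int k) u) 1"
  unfolding monomial_power
  by (rule arg_cong[of _ _ "\<lambda>t. Poly_Mapping.single t 1"], rule poly_mapping_eqI) simp

lemma localization_eq_localized_at:
  assumes I: "bihomogeneous_ideal I" and u: "\<And>v. 0 \<le> Poly_Mapping.lookup u v"
  shows "localization I u = localized_at I (Poly_Mapping.keys u)"
proof (intro equalityI subsetI)
  fix h assume "h \<in> localization I u"
  then obtain k g where g: "g \<in> I" "h = Poly_Mapping.single (frag_cmul (- int k) u) 1 * to_laurent g"
    unfolding localization_def by (auto simp: inverse_monomial_power)
  have "to_laurent g \<in> localized_at I {}" using g by (simp add: localized_at_empty)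
  from localized_at_denominator[OF _ this, of "frag_cmul (int k) u"]
  have "h \<in> localized_at I (Poly_Mapping.keys (frag_cmul (int k) u))"
    using u by (simp add: g(2))
  then show "h \<in> localized_at I (Poly_Mapping.keys u)"
    using localized_at_mono[OF keys_cmul, of I "int k" u] by auto
next
  fix h assume "h \<in> localized_at I (Poly_Mapping.keys u)"
  then obtain N where "Poly_Mapping.single (frag_cmul (int N) u) 1 * h \<in> localized_at I {}"
    using localized_at_clear_denominator[OF I u, of h "{}"] by auto
  then obtain g where g: "g \<in> I" "Poly_Mapping.single (frag_cmul (int N) u) 1 * h = to_laurent g"
    by (auto simp: localized_at_empty)
  have "h = Poly_Mapping.single (- u) 1 ^ N * to_laurent g"
    using monomial_mult_cancel(1)[of "frag_cmul (int N) u" h]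
    by (simp add: g(2) inverse_monomial_power)
  then show "h \<in> localization I u" unfolding localization_def using g(1) by blast
qed

lemma bidegree_integral_exponent:
  "bidegree (integral_exponent t) = (int (fst (bidegree t)), int (snd (bidegree t)))"
  by (simp add: bidegree_def)

definition bicomponent :: "int \<times> int \<Rightarrow> ('n::finite, 'm::finite, 'k::comm_ring_1) bilaurent \<Rightarrow> ('n, 'm, 'k) bilaurent" where
  "bicomponent d = Poly_Mapping.mapp (\<lambda>t c. if bidegree t = d then c else 0)"

lemma lookup_bicomponent:
  "Poly_Mapping.lookup (bicomponent d h) t = (if bidegree t = d then Poly_Mapping.lookup h t else 0)"
  by (auto simp: bicomponent_def lookup_mapp when_def in_keys_iff)

lemma bihomogeneous_iff: "bihomogeneous d h \<longleftrightarrow> (\<forall>t. Poly_Mapping.lookup h t \<noteq> 0 \<longrightarrow> bidegree t = d)"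
  by (auto simp: bihomogeneous_def in_keys_iff)

lemma bihomogeneous_zero: "bihomogeneous d 0"
  by (simp add: bihomogeneous_iff)

lemma bihomogeneous_diff:
  fixes h k :: "('n::finite, 'm::finite, 'k::comm_ring_1) bilaurent"
  assumes "bihomogeneous d h" "bihomogeneous d k"
  shows "bihomogeneous d (h - k)"
  unfolding bihomogeneous_iff
proof (intro allI impI)
  fix t assume "Poly_Mapping.lookup (h - k) t \<noteq> 0"
  then have "Poly_Mapping.lookup h t \<noteq> 0 \<or> Poly_Mapping.lookup k t \<noteq> 0"
    by (auto simp: lookup_minus)
  then show "bidegree t = d" using assms by (auto simp: bihomogeneous_iff)
qed

lemma bihomogeneous_bicomponent: "bihomogeneous d (bicomponent d h)"
  by (simp add: bihomogeneous_iff lookup_bicomponent)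

lemma bicomponent_bihomogeneous:
  "bihomogeneous e h \<Longrightarrow> bicomponent d h = (if d = e then h else 0)"
  by (rule poly_mapping_eqI) (auto simp: lookup_bicomponent bihomogeneous_iff)

lemma additive_bicomponent: "additive (bicomponent d)"
  by unfold_locales (rule poly_mapping_eqI, simp add: lookup_bicomponent lookup_add)

lemmas bicomponent_add = additive.add[OF additive_bicomponent]
  and bicomponent_zero = additive.zero[OF additive_bicomponent]

lemma bidegree_diff:
  fixes s t :: "'n::finite + 'm::finite \<Rightarrow>\<^sub>0 int"
  shows "bidegree (s - t) = (fst (bidegree s) - fst (bidegree t), snd (bidegree s) - snd (bidegree t))"
  by (simp add: bidegree_def lookup_minus sum_subtractf)

lemma bihomogeneous_monomial_mult:
  fixes h :: "('n::finite, 'm::finite, 'k::comm_ring_1) bilaurent"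
  assumes "bihomogeneous d h"
  shows "bihomogeneous (fst (bidegree t) + fst d, snd (bidegree t) + snd d) (Poly_Mapping.single t c * h)"
  unfolding bihomogeneous_iff
proof (intro allI impI)
  fix u assume "Poly_Mapping.lookup (Poly_Mapping.single t c * h) u \<noteq> 0"
  then have "Poly_Mapping.lookup h (u - t) \<noteq> 0" by (auto simp: lookup_monomial_mult)
  then have "bidegree (u - t) = d" using assms by (simp add: bihomogeneous_iff)
  then show "bidegree u = (fst (bidegree t) + fst d, snd (bidegree t) + snd d)"
    by (auto simp: bidegree_diff prod_eq_iff)
qed

lemma bicomponent_monomial_mult:
  fixes h :: "('n::finite, 'm::finite, 'k::comm_ring_1) bilaurent"
  shows "bicomponent (fst (bidegree t) + fst d, snd (bidegree t) + snd d) (Poly_Mapping.single t c * h) =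
    Poly_Mapping.single t c * bicomponent d h"
  by (rule poly_mapping_eqI) (auto simp: lookup_monomial_mult lookup_bicomponent bidegree_diff prod_eq_iff)

lemma bihomogeneous_to_laurent:
  assumes "bihomogeneous d p"
  shows "bihomogeneous (int (fst d), int (snd d)) (to_laurent p)"
  unfolding bihomogeneous_iff
proof (intro allI impI)
  fix t assume "Poly_Mapping.lookup (to_laurent p) t \<noteq> 0"
  then obtain s where "s \<in> Poly_Mapping.keys p" "t = integral_exponent s"
    by (rule lookup_to_laurent_nonzeroE)
  then show "bidegree t = (int (fst d), int (snd d))"
    using assms by (simp add: bihomogeneous_def bidegree_integral_exponent)
qed

text \<open>
  This is where bihomogeneity of \<open>I\<close> enters: a monomial multiple of a bihomogeneous generator is
  bihomogeneous, so taking a component either keeps it or kills it.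
\<close>

lemma bicomponent_ideal:
  assumes I: "bihomogeneous_ideal I" and f: "f \<in> I"
  shows "bicomponent d (to_laurent f) \<in> to_laurent ` I"
proof -
  obtain B where B: "\<And>f. f \<in> B \<Longrightarrow> \<exists>d. bihomogeneous d f" and span: "I = module.span (*) B"
    using I unfolding bihomogeneous_ideal_def by blast
  interpret module "(*) :: ('a, 'b, 'c) bipoly \<Rightarrow> _" by (rule module_times)
  have zero_in: "0 \<in> to_laurent ` I"
    using bihomogeneous_ideal_closed(1)[OF I] by (auto intro!: image_eqI[of _ _ 0])
  have multiple: "bicomponent d (to_laurent (r * b)) \<in> to_laurent ` I" if b: "b \<in> B" for r b
  proof (induction r rule: poly_mapping_add_induct)
    case (single s c)
    obtain d' where "bihomogeneous d' b" using B b by blast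
    then have "\<exists>e. bihomogeneous e (to_laurent (Poly_Mapping.single s c * b))"
      unfolding to_laurent_monomial_mult
      using bihomogeneous_monomial_mult bihomogeneous_to_laurent by blast
    moreover have "Poly_Mapping.single s c * b \<in> I"
      using b by (simp add: span span_base span_scale)
    ultimately show ?case using zero_in by (auto simp: bicomponent_bihomogeneous)
  next
    case (add r r')
    then show ?case
      by (auto simp: distrib_right to_laurent_add bicomponent_add intro: to_laurent_image_closed(1)[OF I])
  qed
  show ?thesis
    using f unfolding span
  proof (induction rule: span_induct_alt)
    case base
    then show ?case using zero_in by (simp add: bicomponent_zero flip: span)
  next
    case (step r b f)
    then show ?case
      using to_laurent_image_closed(1)[OF I multiple]
      by (simp add: to_laurent_add bicomponent_add flip: span)
  qed
qed

lemma bicomponent_localized_at: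
  assumes I: "bihomogeneous_ideal I" and h: "h \<in> localized_at I V"
  shows "bicomponent d h \<in> localized_at I V"
proof -
  obtain t where t: "\<And>v. 0 \<le> Poly_Mapping.lookup t v" "Poly_Mapping.keys t \<subseteq> V"
    "Poly_Mapping.single t 1 * h \<in> to_laurent ` I"
    using h unfolding localized_at_def by blast
  then have "Poly_Mapping.single t 1 * bicomponent d h \<in> to_laurent ` I"
    unfolding bicomponent_monomial_mult[symmetric] using bicomponent_ideal[OF I] by auto
  then show ?thesis unfolding localized_at_def using t by blast
qed

definition graded_localized_at ::
  "('n::finite, 'm::finite, 'k::comm_ring_1) bipoly set \<Rightarrow> int \<times> int \<Rightarrow> ('n + 'm) set \<Rightarrow> ('n, 'm, 'k) bilaurent set" where
  "graded_localized_at I d V = {h \<in> localized_at I V. bihomogeneous d h}"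

lemma subgroup_system_graded_localized_at:
  "bihomogeneous_ideal I \<Longrightarrow> subgroup_system (graded_localized_at I d)"
  by unfold_locales
    (auto simp: graded_localized_at_def localized_at_zero localized_at_diff bihomogeneous_zero
      bihomogeneous_diff dest: localized_at_mono)

section \<open>Local cohomology and exactness of Cech complexes\<close>

lemma additive_sign:
  assumes "additive \<phi>"
  shows "\<phi> ((-1) ^ k * x) = (-1 :: 'b::comm_ring_1) ^ k * (\<phi> (x :: 'a::comm_ring_1) :: 'b)"
  using additive.minus[OF assms] by (cases "even k") simp_all

lemma coboundary_additive:
  assumes "additive \<phi>"
  shows "coboundary (\<lambda>A. \<phi> (c A)) A = \<phi> (coboundary c A)"
  by (simp add: coboundary_def additive.sum[OF assms] additive_sign[OF assms])

lemma coboundary_eq_zero_card: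
  fixes c :: "'g::{finite,linorder} set \<Rightarrow> 'v::comm_ring_1"
  assumes "\<And>A. card A \<noteq> p \<Longrightarrow> c A = 0" and A: "card A \<noteq> Suc p"
  shows "coboundary c A = 0"
  unfolding coboundary_def
proof (rule sum.neutral, rule ballI)
  fix a assume a: "a \<in> A"
  then have "Suc (card (A - {a})) = card A" by (intro card_Suc_Diff1) auto
  then show "(-1) ^ card {b\<in>A. b < a} * c (A - {a}) = 0" using assms(1)[of "A - {a}"] A by auto
qed

lemma cech_differential_eq_coboundary:
  assumes "c \<in> cech_cochains f I p"
  shows "cech_differential p c = coboundary c"
proof
  fix A
  show "cech_differential p c A = coboundary c A"
    using assms coboundary_eq_zero_card[of p c A]
    by (auto simp: cech_cochains_def cech_differential_def coboundary_def)
qed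

text \<open>
  Translation between the Cech cohomology of a family of monomials and exactness of the complexes
  above over \<open>graded_localized_at I d\<close>.
\<close>

locale monomial_family =
  fixes f :: "'g::{finite,linorder} \<Rightarrow> ('n::finite + 'm::finite \<Rightarrow>\<^sub>0 int)"
    and I :: "('n, 'm, 'k::comm_ring_1) bipoly set"
  assumes nonneg: "0 \<le> Poly_Mapping.lookup (f a) v"
    and ideal: "bihomogeneous_ideal I"
begin

lemma keys_sum_family: "Poly_Mapping.keys (\<Sum>a\<in>A. f a) = (\<Union>a\<in>A. Poly_Mapping.keys (f a))"
proof -
  have "(\<Sum>a\<in>A. Poly_Mapping.lookup (f a) v) \<noteq> 0 \<longleftrightarrow> (\<exists>a\<in>A. Poly_Mapping.lookup (f a) v \<noteq> 0)" for v
    by (subst sum_nonneg_eq_0_iff) (auto simp: nonneg)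
  then show ?thesis by (auto simp: in_keys_iff lookup_sum)
qed

lemma localization_sum_family:
  "localization I (\<Sum>a\<in>A. f a) = localized_at I (\<Union>a\<in>A. Poly_Mapping.keys (f a))"
  by (subst localization_eq_localized_at[OF ideal])
    (auto simp: lookup_sum keys_sum_family intro!: sum_nonneg nonneg)

lemma cochain_iff:
  "c \<in> cech_cochains f I p \<longleftrightarrow>
    (\<forall>A. (card A = p \<longrightarrow> c A \<in> localized_at I (\<Union>a\<in>A. Poly_Mapping.keys (f a))) \<and> (card A \<noteq> p \<longrightarrow> c A = 0))"
  by (simp add: cech_cochains_def localization_sum_family)

lemma graded_cochain_iff:
  "c \<in> cech_cochains f I p \<and> (\<forall>A. bihomogeneous d (c A)) \<longleftrightarrow>
    cech_cochain (graded_localized_at I d) (\<lambda>a. Poly_Mapping.keys (f a)) UNIV {} (int p) c"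
proof -
  have "c \<in> cech_cochains f I p \<and> (\<forall>A. bihomogeneous d (c A)) \<longleftrightarrow>
      (\<forall>A. (if card A = p then c A \<in> localized_at I (\<Union>a\<in>A. Poly_Mapping.keys (f a)) else c A = 0)
        \<and> bihomogeneous d (c A))"
    by (simp only: cech_cochains_def localization_sum_family mem_Collect_eq all_conj_distrib)
  also have "\<dots> \<longleftrightarrow> (\<forall>A. (c A \<in> localized_at I (\<Union>a\<in>A. Poly_Mapping.keys (f a)) \<and> bihomogeneous d (c A))
        \<and> (c A \<noteq> 0 \<longrightarrow> card A = p))"
    by (rule all_cong1) (use localized_at_zero[OF ideal] bihomogeneous_zero in auto)
  finally show ?thesis
    by (simp add: cech_cochain_def graded_localized_at_def)
qed

lemma cochains_diff:
  "c \<in> cech_cochains f I p \<Longrightarrow> c' \<in> cech_cochains f I p \<Longrightarrow> (\<lambda>A. c A - c' A) \<in> cech_cochains f I p"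
  by (auto simp: cochain_iff localized_at_diff[OF ideal])

lemma zero_cochain: "(\<lambda>A. 0) \<in> cech_cochains f I p"
  by (auto simp: cochain_iff localized_at_zero[OF ideal])

lemma zero_cocycle: "(\<lambda>A. 0) \<in> cech_cocycles f I p"
  by (auto simp: cech_cocycles_def zero_cochain cech_differential_def)

lemma coboundaries_diff:
  assumes "c \<in> cech_coboundaries f I p" "c' \<in> cech_coboundaries f I p"
  shows "(\<lambda>A. c A - c' A) \<in> cech_coboundaries f I p"
proof (cases p)
  case 0
  then show ?thesis using assms by (simp add: cech_coboundaries_def)
next
  case (Suc q)
  then obtain e e' where e: "e \<in> cech_cochains f I q" "e' \<in> cech_cochains f I q"
    and c: "c = coboundary e" "c' = coboundary e'"
    using assms by (auto simp: cech_coboundaries_def cech_differential_eq_coboundary)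
  have "(\<lambda>A. c A - c' A) = cech_differential q (\<lambda>A. e A - e' A)"
    by (simp add: cech_differential_eq_coboundary[OF cochains_diff[OF e]] c coboundary_diff fun_eq_iff)
  then show ?thesis using cochains_diff[OF e] Suc by (simp add: cech_coboundaries_def)
qed

lemma zero_coboundary: "(\<lambda>A. 0) \<in> cech_coboundaries f I p"
proof (cases p)
  case (Suc q)
  have "(\<lambda>A. 0) = cech_differential q (\<lambda>A. 0 :: ('n, 'm, 'k) bilaurent)"
    by (simp add: cech_differential_def fun_eq_iff)
  then show ?thesis using Suc zero_cochain[of q] by (auto simp: cech_coboundaries_def)
qed (simp add: cech_coboundaries_def)

lemma class_eq_zero_iff:
  assumes c: "c \<in> cech_cocycles f I p"
  shows "cohomologous f I p `` {c} = zero_class f I p \<longleftrightarrow> c \<in> cech_coboundaries f I p"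
proof
  assume *: "cohomologous f I p `` {c} = zero_class f I p"
  have "(\<lambda>A. 0) \<in> zero_class f I p"
    by (simp add: zero_class_def cohomologous_def zero_cocycle zero_coboundary)
  then have "(\<lambda>A. 0) \<in> cohomologous f I p `` {c}" by (simp add: *)
  then show "c \<in> cech_coboundaries f I p" by (simp add: cohomologous_def)
next
  assume B: "c \<in> cech_coboundaries f I p"
  have "(\<lambda>A. c A - c' A) \<in> cech_coboundaries f I p \<longleftrightarrow> (\<lambda>A. 0 - c' A) \<in> cech_coboundaries f I p" for c'
    using coboundaries_diff[OF _ B, of "\<lambda>A. c A - c' A"]
      coboundaries_diff[OF B coboundaries_diff[OF zero_coboundary], of "\<lambda>A. 0 - c' A"]
    by (auto simp: algebra_simps)
  then show "cohomologous f I p `` {c} = zero_class f I p"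
    unfolding zero_class_def cohomologous_def using c zero_cocycle by auto
qed

text \<open>
  A primitive of a bihomogeneous cocycle need not be bihomogeneous, but its component of the right
  bidegree is again a primitive, since the differential preserves bidegrees.
\<close>

lemma graded_cohomology_vanishes_iff:
  assumes p: "1 \<le> p"
  shows "local_cohomology_graded f I p d = {zero_class f I p} \<longleftrightarrow>
    cech_exact (graded_localized_at I d) (\<lambda>a. Poly_Mapping.keys (f a)) UNIV {} (int p)"
proof -
  obtain q where q: "p = Suc q" using p by (cases p) auto
  have "local_cohomology_graded f I p d = {zero_class f I p} \<longleftrightarrow>
    (\<forall>c \<in> cech_cocycles f I p. (\<forall>A. bihomogeneous d (c A)) \<longrightarrow> cohomologous f I p `` {c} = zero_class f I p)"
    (is "?L \<longleftrightarrow> ?R")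
  proof
    assume ?R
    moreover have "zero_class f I p \<in> local_cohomology_graded f I p d"
      unfolding local_cohomology_graded_def zero_class_def
      using zero_cocycle bihomogeneous_zero by blast
    ultimately show ?L unfolding local_cohomology_graded_def by blast
  next
    assume L: ?L
    show ?R
    proof (intro ballI impI)
      fix c assume "c \<in> cech_cocycles f I p" "\<forall>A. bihomogeneous d (c A)"
      then have "cohomologous f I p `` {c} \<in> local_cohomology_graded f I p d"
        unfolding local_cohomology_graded_def mem_Collect_eq by (intro exI[of _ c] conjI refl)
      then show "cohomologous f I p `` {c} = zero_class f I p" by (simp add: L)
    qed
  qed
  also have "\<dots> \<longleftrightarrow> (\<forall>c. cech_cochain (graded_localized_at I d) (\<lambda>a. Poly_Mapping.keys (f a)) UNIV {} (int p) c
      \<and> (\<forall>A. coboundary c A = 0) \<longrightarrow> c \<in> cech_coboundaries f I p)"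
    by (auto simp: class_eq_zero_iff cech_cocycles_def cech_differential_eq_coboundary fun_eq_iff
        simp flip: graded_cochain_iff)
  also have "\<dots> \<longleftrightarrow> cech_exact (graded_localized_at I d) (\<lambda>a. Poly_Mapping.keys (f a)) UNIV {} (int p)"
    unfolding cech_exact_def
  proof (intro all_cong1 imp_cong refl)
    show "(cech_cochain (graded_localized_at I d) (\<lambda>a. Poly_Mapping.keys (f a)) UNIV {} (int p) c
      \<and> (\<forall>A. coboundary c A = 0)) =
      (cech_cochain (graded_localized_at I d) (\<lambda>a. Poly_Mapping.keys (f a)) UNIV {} (int p) c
      \<and> (\<forall>A\<subseteq>UNIV. coboundary c A = 0))" for c
      by simp
  next
    fix c :: "'g set \<Rightarrow> ('n, 'm, 'k) bilaurent"
    assume c: "cech_cochain (graded_localized_at I d) (\<lambda>a. Poly_Mapping.keys (f a)) UNIV {} (int p) c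
      \<and> (\<forall>A\<subseteq>UNIV. coboundary c A = 0)"
    show "c \<in> cech_coboundaries f I p \<longleftrightarrow>
      (\<exists>e. cech_cochain (graded_localized_at I d) (\<lambda>a. Poly_Mapping.keys (f a)) UNIV {} (int p - 1) e
        \<and> (\<forall>A\<subseteq>UNIV. coboundary e A = c A))"
    proof
      assume "c \<in> cech_coboundaries f I p"
      then obtain e where e: "e \<in> cech_cochains f I q" "c = coboundary e"
        by (auto simp: q cech_coboundaries_def cech_differential_eq_coboundary)
      have "(\<lambda>A. bicomponent d (e A)) \<in> cech_cochains f I q"
        using e(1) by (auto simp: cochain_iff bicomponent_localized_at[OF ideal]
            bicomponent_zero)
      then have "cech_cochain (graded_localized_at I d) (\<lambda>a. Poly_Mapping.keys (f a)) UNIV {} (int q)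
          (\<lambda>A. bicomponent d (e A))"
        by (simp add: bihomogeneous_bicomponent flip: graded_cochain_iff)
      moreover have "coboundary (\<lambda>A. bicomponent d (e A)) A = c A" for A
      proof -
        have "bihomogeneous d (c A)" using c by (simp flip: graded_cochain_iff)
        then show ?thesis
          by (simp add: coboundary_additive[OF additive_bicomponent] bicomponent_bihomogeneous flip: e(2))
      qed
      ultimately show "\<exists>e. cech_cochain (graded_localized_at I d) (\<lambda>a. Poly_Mapping.keys (f a)) UNIV {} (int p - 1) e
        \<and> (\<forall>A\<subseteq>UNIV. coboundary e A = c A)"
        by (auto simp: q)
    next
      assume "\<exists>e. cech_cochain (graded_localized_at I d) (\<lambda>a. Poly_Mapping.keys (f a)) UNIV {} (int p - 1) e
        \<and> (\<forall>A\<subseteq>UNIV. coboundary e A = c A)"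
      then obtain e where e: "e \<in> cech_cochains f I q" "\<And>A. coboundary e A = c A"
        by (auto simp: q simp flip: graded_cochain_iff)
      then have "c = cech_differential q e" by (simp add: cech_differential_eq_coboundary fun_eq_iff)
      then show "c \<in> cech_coboundaries f I p" using e(1) by (auto simp: q cech_coboundaries_def)
    qed
  qed
  finally show ?thesis .
qed

end

section \<open>Comparison of the supports\<close>

text \<open>
  Exactness in all large \<open>x\<close>-degrees gives exactness in every \<open>x\<close>-degree after inverting some of the
  \<open>x\<close>-variables: multiplication by a power of their product \<open>u\<close> clears the denominators, raises the
  \<open>x\<close>-degree, and leaves the \<open>y\<close>-degree unchanged.
\<close>

lemma exact_localization:
  fixes I :: "('n::finite, 'm::finite, 'k::comm_ring_1) bipoly set"
    and \<sigma> :: "'g::{finite,linorder} \<Rightarrow> ('n + 'm) set"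
  assumes I: "bihomogeneous_ideal I" and V: "V \<noteq> {}"
    and ex: "\<And>a'. a \<le> a' \<Longrightarrow> cech_exact (graded_localized_at I (a', b)) \<sigma> F {} p"
  shows "cech_exact (graded_localized_at I (a\<^sub>0, b)) \<sigma> F (Inl ` V) p"
  unfolding cech_exact_def
proof (intro allI impI, elim conjE)
  fix c assume c: "cech_cochain (graded_localized_at I (a\<^sub>0, b)) \<sigma> F (Inl ` V) p c"
    and cocycle: "\<forall>A\<subseteq>F. coboundary c A = 0"
  define u :: "'n + 'm \<Rightarrow>\<^sub>0 int" where "u = (\<Sum>v\<in>V. Poly_Mapping.single (Inl v) 1)"
  have lookup_u: "Poly_Mapping.lookup u v = (if v \<in> Inl ` V then 1 else 0)" for v
    by (cases v) (auto simp: u_def lookup_sum lookup_single when_def image_iff)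
  have keys_u: "Poly_Mapping.keys u = Inl ` V"
    by (auto simp: in_keys_iff lookup_u split: if_splits)
  have u: "0 \<le> Poly_Mapping.lookup u v" for v by (simp add: lookup_u)
  have degree_u: "bidegree u = (int (card V), 0)"
    by (simp add: bidegree_def lookup_u image_iff sum.If_cases)
  have degree_Nu: "bidegree (frag_cmul k u) = (k * int (card V), 0)" for k
    using degree_u by (simp add: bidegree_def flip: sum_distrib_left)
  have "\<exists>N\<^sub>0. \<forall>N\<ge>N\<^sub>0. Poly_Mapping.single (frag_cmul (int N) u) 1 * c A \<in> localized_at I (\<Union>(\<sigma> ` A))"
    if "A \<subseteq> F" for A
    using c that by (intro localized_at_clear_denominator[OF I u])
      (auto simp: cech_cochain_def graded_localized_at_def keys_u)
  then obtain N\<^sub>0 where N0: "\<And>A N. A \<subseteq> F \<Longrightarrow> N\<^sub>0 A \<le> N \<Longrightarrow>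
      Poly_Mapping.single (frag_cmul (int N) u) 1 * c A \<in> localized_at I (\<Union>(\<sigma> ` A))"
    by metis
  \<comment> \<open>Large enough for all values of \<open>c\<close>, and to move the \<open>x\<close>-degree from \<open>a\<^sub>0\<close> to at least \<open>a\<close>.\<close>
  define N where "N = nat (a - a\<^sub>0) + (\<Sum>A\<in>UNIV. N\<^sub>0 A)"
  have N: "N\<^sub>0 A \<le> N" for A
  proof -
    have "N\<^sub>0 A \<le> (\<Sum>A\<in>UNIV. N\<^sub>0 A)" by (intro member_le_sum) auto
    then show ?thesis by (simp add: N_def)
  qed
  define w where "w = frag_cmul (int N) u"
  define a' where "a' = int N * int (card V) + a\<^sub>0"
  have "1 \<le> int (card V)" using V by (simp add: Suc_le_eq card_gt_0_iff)
  then have "int N * 1 \<le> int N * int (card V)" by (intro mult_left_mono) auto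
  moreover have "a - a\<^sub>0 \<le> int N" unfolding N_def by linarith
  ultimately have a': "a \<le> a'" by (simp add: a'_def)
  have degree_w: "bidegree w = (int N * int (card V), 0)" by (simp add: w_def degree_Nu)
  have "cech_cochain (graded_localized_at I (a', b)) \<sigma> F {} p (\<lambda>A. Poly_Mapping.single w 1 * c A)"
    unfolding cech_cochain_def
  proof (intro allI impI)
    fix A assume A: "A \<subseteq> F"
    then have cA: "bihomogeneous (a\<^sub>0, b) (c A)" "c A \<noteq> 0 \<longrightarrow> int (card A) = p"
      using c by (auto simp: cech_cochain_def graded_localized_at_def)
    have "bihomogeneous (a', b) (Poly_Mapping.single w 1 * c A)"
      using bihomogeneous_monomial_mult[OF cA(1), of w 1] by (simp add: degree_w a'_def)
    moreover have "Poly_Mapping.single w 1 * c A \<in> localized_at I (\<Union>(\<sigma> ` A))"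
      using N0[OF A N] by (simp add: w_def)
    ultimately show "Poly_Mapping.single w 1 * c A \<in> graded_localized_at I (a', b) ({} \<union> \<Union>(\<sigma> ` A)) \<and>
        (Poly_Mapping.single w 1 * c A \<noteq> 0 \<longrightarrow> int (card A) = p)"
      using cA(2) by (auto simp: graded_localized_at_def)
  qed
  moreover have "\<forall>A\<subseteq>F. coboundary (\<lambda>A. Poly_Mapping.single w 1 * c A) A = 0"
    using cocycle by (simp add: coboundary_mult)
  ultimately obtain e where e: "cech_cochain (graded_localized_at I (a', b)) \<sigma> F {} (p - 1) e"
    "\<forall>A\<subseteq>F. coboundary e A = Poly_Mapping.single w 1 * c A"
    by (rule cech_exactE[OF ex[OF a']])
  have "cech_cochain (graded_localized_at I (a\<^sub>0, b)) \<sigma> F (Inl ` V) (p - 1) (\<lambda>A. Poly_Mapping.single (- w) 1 * e A)"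
    unfolding cech_cochain_def
  proof (intro allI impI)
    fix A assume A: "A \<subseteq> F"
    then have eA: "e A \<in> localized_at I (\<Union>(\<sigma> ` A))" "bihomogeneous (a', b) (e A)"
      "e A \<noteq> 0 \<longrightarrow> int (card A) = p - 1"
      using e(1) by (auto simp: cech_cochain_def graded_localized_at_def)
    have "bidegree (- w) = (- int N * int (card V), 0)"
      using degree_Nu[of "- int N"] by (simp add: w_def minus_frag_cmul)
    then have "bihomogeneous (a\<^sub>0, b) (Poly_Mapping.single (- w) 1 * e A)"
      using bihomogeneous_monomial_mult[OF eA(2), of "- w" 1] by (simp add: a'_def)
    moreover have "Poly_Mapping.single (- w) 1 * e A \<in> localized_at I (Poly_Mapping.keys w \<union> \<Union>(\<sigma> ` A))"
      by (rule localized_at_denominator[OF _ eA(1)]) (simp add: w_def u)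
    moreover have "Poly_Mapping.keys w \<subseteq> Inl ` V" unfolding w_def keys_u[symmetric] by (rule keys_cmul)
    ultimately show "Poly_Mapping.single (- w) 1 * e A \<in> graded_localized_at I (a\<^sub>0, b) (Inl ` V \<union> \<Union>(\<sigma> ` A)) \<and>
        (Poly_Mapping.single (- w) 1 * e A \<noteq> 0 \<longrightarrow> int (card A) = p - 1)"
      using eA(3) localized_at_mono[of "Poly_Mapping.keys w \<union> \<Union>(\<sigma> ` A)" "Inl ` V \<union> \<Union>(\<sigma> ` A)" I]
      by (auto simp: graded_localized_at_def)
  qed
  moreover have "\<forall>A\<subseteq>F. coboundary (\<lambda>A. Poly_Mapping.single (- w) 1 * e A) A = c A"
    using e(2) by (simp add: coboundary_mult monomial_mult_cancel)
  ultimately show "\<exists>e. cech_cochain (graded_localized_at I (a\<^sub>0, b)) \<sigma> F (Inl ` V) (p - 1) e \<and>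
      (\<forall>A\<subseteq>F. coboundary e A = c A)"
    by blast
qed

text \<open>
  The combined family of generators: \<open>(i, None)\<close> stands for \<open>x\<^sub>i\<close> and \<open>(i, Some j)\<close> for \<open>x\<^sub>i y\<^sub>j\<close>. With
  this encoding both original index types embed monotonically.
\<close>

definition mixed_gens :: "'n::finite \<times> 'm::finite option \<Rightarrow> ('n + 'm \<Rightarrow>\<^sub>0 int)" where
  "mixed_gens = (\<lambda>(i, j). case j of None \<Rightarrow> mx_gens i | Some j \<Rightarrow> b_gens (i, j))"

lemma keys_mx_gens: "Poly_Mapping.keys (mx_gens i) = {Inl i}"
  by (simp add: mx_gens_def)

lemma keys_b_gens: "Poly_Mapping.keys (b_gens (i, j)) = {Inl i, Inr j}"
  by (auto simp: b_gens_def in_keys_iff lookup_add lookup_single when_def split: if_splits)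

lemma mx_gens_nonneg: "0 \<le> Poly_Mapping.lookup (mx_gens i) v"
  by (simp add: mx_gens_def lookup_single when_def)

lemma b_gens_nonneg: "0 \<le> Poly_Mapping.lookup (b_gens ij) v"
  by (cases ij) (simp add: b_gens_def lookup_add lookup_single when_def)

abbreviation mixed_support :: "'n::finite \<times> 'm::finite option \<Rightarrow> ('n + 'm) set" where
  "mixed_support ij \<equiv> Poly_Mapping.keys (mixed_gens ij)"

lemma mx_vanishes_iff:
  fixes I :: "('n::{finite,linorder}, 'm::{finite,linorder}, 'k::comm_ring_1) bipoly set"
  assumes "bihomogeneous_ideal I" "1 \<le> p"
  shows "local_cohomology_graded mx_gens I p d = {zero_class mx_gens I p} \<longleftrightarrow>
    cech_exact (graded_localized_at I d) mixed_support (range (\<lambda>i. (i, None))) {} (int p)"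
proof -
  interpret monomial_family mx_gens I
    using assms(1) mx_gens_nonneg by unfold_locales
  have "strict_mono (\<lambda>i::'n. (i, None :: 'm option))" by (simp add: strict_mono_def)
  then show ?thesis
    by (simp add: cech_exact_range graded_cohomology_vanishes_iff[OF assms(2)] comp_def mixed_gens_def)
qed

lemma b_vanishes_iff:
  fixes I :: "('n::{finite,linorder}, 'm::{finite,linorder}, 'k::comm_ring_1) bipoly set"
  assumes "bihomogeneous_ideal I" "1 \<le> p"
  shows "local_cohomology_graded b_gens I p d = {zero_class b_gens I p} \<longleftrightarrow>
    cech_exact (graded_localized_at I d) mixed_support (range (\<lambda>(i, j). (i, Some j))) {} (int p)"
proof -
  interpret monomial_family b_gens I
    using assms(1) b_gens_nonneg by unfold_locales
  have "strict_mono (\<lambda>(i::'n, j::'m). (i, Some j))" by (auto simp: strict_mono_def less_prod_def)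
  then show ?thesis
    by (simp add: cech_exact_range graded_cohomology_vanishes_iff[OF assms(2)] comp_def mixed_gens_def
        case_prod_unfold)
qed

text \<open>
  Degree \<open>0\<close> is the statement that restriction to a localization is injective, which is built in
  since all localizations lie in one ring.
\<close>

lemma (in subgroup_system) exact_nonpos:
  fixes \<sigma> :: "'g::{finite,linorder} \<Rightarrow> 'w set"
  assumes "F \<noteq> {}" "p \<le> 0"
  shows "cech_exact M \<sigma> F V p"
  unfolding cech_exact_def
proof (intro allI impI, elim conjE)
  fix c assume c: "cech_cochain M \<sigma> F V p c" and cocycle: "\<forall>A\<subseteq>F. coboundary c A = 0"
  obtain g where g: "g \<in> F" using assms(1) by blast
  have "coboundary c {g} = 0" using cocycle g by simp
  moreover have "{b. b = g \<and> b < g} = {}" by auto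
  ultimately have c_empty: "c {} = 0" by (simp add: coboundary_def)
  have "c A = 0" if A: "A \<subseteq> F" for A
  proof (cases "A = {}")
    case False
    then have "0 < card A" by (simp add: card_gt_0_iff)
    then have "int (card A) \<noteq> p" using assms(2) by linarith
    then show ?thesis using c A unfolding cech_cochain_def by blast
  qed (simp add: c_empty)
  then show "\<exists>e. cech_cochain M \<sigma> F V (p - 1) e \<and> (\<forall>A\<subseteq>F. coboundary e A = c A)"
    by (intro exI[of _ "\<lambda>_. 0"]) (simp add: cech_cochain_def zero coboundary_def)
qed

section \<open>The cohomological dimension\<close>

lemma (in monomial_family) cohomology_vanishes_above:
  assumes "card (UNIV :: 'g set) < p"
  shows "local_cohomology f I p = {zero_class f I p}"
proof -
  have "cech_cocycles f I p = {\<lambda>A. 0}"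
  proof (intro equalityI subsetI)
    fix c assume "c \<in> cech_cocycles f I p"
    then have "c A = 0" if "card A \<noteq> p" for A
      using that by (auto simp: cech_cocycles_def cochain_iff)
    moreover have "card A \<noteq> p" for A :: "'g set"
      using assms card_mono[of UNIV A] by auto
    ultimately show "c \<in> {\<lambda>A. 0}" by auto
  qed (simp add: zero_cocycle)
  then show ?thesis by (simp add: local_cohomology_def quotient_def zero_class_def)
qed

text \<open>
  In the top degree \<open>n + 1\<close> every cochain is a cocycle. For \<open>0 \<noteq> f \<in> I\<close> and large \<open>N\<close>, the quotient of
  \<open>f\<close> by the \<open>N\<close>-th power of \<open>x\<^sub>0 \<cdots> x\<^sub>n\<close> has a term all of whose \<open>x\<close>-exponents are negative. No element of a
  localization at the \<open>x\<^sub>i\<close> with \<open>i \<noteq> a\<close> contains such a term, as the exponent of \<open>x\<^sub>a\<close> is nonnegative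
  there, so the cocycle is not a coboundary.
\<close>

lemma top_cohomology_nonzero:
  fixes I :: "('n::{finite,linorder}, 'm::{finite,linorder}, 'k::comm_ring_1) bipoly set"
  assumes I: "bihomogeneous_ideal I" and "I \<noteq> {0}"
  shows "local_cohomology mx_gens I (card (UNIV :: 'n set)) \<noteq> {zero_class mx_gens I (card (UNIV :: 'n set))}"
proof
  let ?n = "card (UNIV :: 'n set)"
  assume vanishes: "local_cohomology mx_gens I ?n = {zero_class mx_gens I ?n}"
  interpret monomial_family "mx_gens :: 'n \<Rightarrow> 'n + 'm \<Rightarrow>\<^sub>0 int" I
    using I mx_gens_nonneg by unfold_locales
  obtain q where q: "?n = Suc q" by (metis card_gt_0_iff finite UNIV_not_empty gr0_implies_Suc)
  obtain f where f: "f \<in> I" "f \<noteq> 0" using assms bihomogeneous_ideal_closed(1)[OF I] by blast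
  then obtain s where s: "Poly_Mapping.lookup f s \<noteq> 0" by (metis lookup_zero poly_mapping_eqI)
  define u :: "'n + 'm \<Rightarrow>\<^sub>0 int" where "u = (\<Sum>i\<in>UNIV. mx_gens i)"
  have lookup_u: "Poly_Mapping.lookup u (Inl i) = 1" for i
    by (simp add: u_def lookup_sum mx_gens_def lookup_single when_def)
  define N where "N = Suc (\<Sum>v\<in>UNIV. Poly_Mapping.lookup s v)"
  have N: "Poly_Mapping.lookup s v < N" for v
    unfolding N_def less_Suc_eq_le by (intro member_le_sum) auto
  define h where "h = Poly_Mapping.single (- u) 1 ^ N * to_laurent f"
  define t where "t = integral_exponent s + frag_cmul (- int N) u"
  have t_neg: "Poly_Mapping.lookup t (Inl i) < 0" for i
    using N[of "Inl i"] by (simp add: t_def lookup_add lookup_u)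
  have h_t: "Poly_Mapping.lookup h t \<noteq> 0"
    using s by (simp add: h_def inverse_monomial_power lookup_monomial_mult t_def lookup_to_laurent)
  define c where "c = (\<lambda>A :: 'n set. if A = UNIV then h else 0)"
  have card_n: "card A = ?n \<longleftrightarrow> A = UNIV" for A :: "'n set"
    using card_subset_eq[of UNIV A] by auto
  have "h \<in> localization I (\<Sum>a\<in>UNIV. mx_gens a)"
    using f(1) unfolding localization_def h_def u_def by blast
  then have "c \<in> cech_cochains mx_gens I ?n"
    unfolding cech_cochains_def by (simp add: c_def card_n)
  moreover have "cech_differential ?n c = (\<lambda>A. 0)"
  proof
    fix A :: "'n set"
    have "card A \<noteq> Suc ?n" using card_mono[of UNIV A] by auto
    then show "cech_differential ?n c A = 0" by (simp add: cech_differential_def)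
  qed
  ultimately have c: "c \<in> cech_cocycles mx_gens I ?n" by (simp add: cech_cocycles_def)
  then have "cohomologous mx_gens I ?n `` {c} \<in> local_cohomology mx_gens I ?n"
    unfolding local_cohomology_def by (rule quotientI)
  then have "c \<in> cech_coboundaries mx_gens I ?n"
    using class_eq_zero_iff[OF c] vanishes by simp
  then obtain e where e: "e \<in> cech_cochains mx_gens I q" "c = coboundary e"
    by (auto simp: q cech_coboundaries_def cech_differential_eq_coboundary)
  have "Poly_Mapping.lookup (e (UNIV - {a})) t = 0" for a
  proof (rule ccontr)
    assume nz: "Poly_Mapping.lookup (e (UNIV - {a})) t \<noteq> 0"
    have "card (UNIV - {a}) = q" using q by simp
    then have "e (UNIV - {a}) \<in> localization I (\<Sum>b\<in>UNIV - {a}. mx_gens b)"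
      using e(1) by (auto simp: cech_cochains_def)
    then obtain k g where g: "e (UNIV - {a}) =
        Poly_Mapping.single (frag_cmul (- int k) (\<Sum>b\<in>UNIV - {a}. mx_gens b)) 1 * to_laurent g"
      unfolding localization_def by (auto simp: inverse_monomial_power)
    let ?w = "\<Sum>b\<in>UNIV - {a}. mx_gens b :: 'n + 'm \<Rightarrow>\<^sub>0 int"
    have "Poly_Mapping.lookup (to_laurent g) (t - frag_cmul (- int k) ?w) \<noteq> 0"
      using nz by (simp add: g lookup_monomial_mult)
    then obtain r where r: "t - frag_cmul (- int k) ?w = integral_exponent r"
      by (rule lookup_to_laurent_nonzeroE)
    have "Poly_Mapping.lookup ?w (Inl a) = 0"
      by (simp add: lookup_sum mx_gens_def lookup_single when_def)
    then have "Poly_Mapping.lookup t (Inl a) = int (Poly_Mapping.lookup r (Inl a))"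
      using arg_cong[OF r, of "\<lambda>w. Poly_Mapping.lookup w (Inl a)"] by (simp add: lookup_minus)
    with t_neg[of a] show False by simp
  qed
  then have "coboundary (\<lambda>A. Poly_Mapping.lookup (e A) t) UNIV = 0"
    by (simp add: coboundary_def)
  moreover have "additive (\<lambda>x :: ('n, 'm, 'k) bilaurent. Poly_Mapping.lookup x t)"
    by unfold_locales (rule lookup_add)
  ultimately have "Poly_Mapping.lookup (coboundary e UNIV) t = 0"
    using coboundary_additive[of "\<lambda>x :: ('n, 'm, 'k) bilaurent. Poly_Mapping.lookup x t" e UNIV] by simp
  with h_t show False by (simp add: c_def flip: e(2))
qed

lemma card_le_cd_mx:
  fixes I :: "('n::{finite,linorder}, 'm::{finite,linorder}, 'k::comm_ring_1) bipoly set"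
  assumes I: "bihomogeneous_ideal I" "I \<noteq> {0}"
  shows "card (UNIV :: 'n set) \<le> cd_mx I"
proof -
  interpret monomial_family "mx_gens :: 'n \<Rightarrow> 'n + 'm \<Rightarrow>\<^sub>0 int" I
    using I mx_gens_nonneg by unfold_locales
  let ?S = "{i. i > 0 \<and> local_cohomology mx_gens I i \<noteq> {zero_class mx_gens I i}}"
  have "?S \<subseteq> {..card (UNIV :: 'n set)}" using cohomology_vanishes_above by (force simp: not_less[symmetric])
  then have "finite ?S" by (rule finite_subset) simp
  moreover have "card (UNIV :: 'n set) \<in> ?S"
    using top_cohomology_nonzero[OF I] by (simp add: card_gt_0_iff)
  ultimately show ?thesis unfolding cd_mx_def by (intro Max_ge) auto
qed

section \<open>Regularity regions\<close>

text \<open>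
  The first localizations that occur are at one \<open>x\<^sub>k\<close>, the later ones at several of them; this is why the
  class of localizations passed to \<open>exact_union\<close> consists of the nonempty sets of \<open>x\<close>-variables.
\<close>

lemma reg_subset_x_reg:
  fixes I :: "('n::{finite,linorder}, 'm::{finite,linorder}, 'k::comm_ring_1) bipoly set"
  assumes I: "bihomogeneous_ideal I"
  shows "reg I \<subseteq> x_reg I"
proof (intro subsetI, clarify)
  fix a b assume ab: "(a, b) \<in> reg I"
  let ?B = "range (\<lambda>(i::'n, j::'m). (i, Some j))" and ?X = "range (\<lambda>i::'n. (i, None :: 'm option))"
  let ?M = "graded_localized_at I"
  have b_exact: "cech_exact (?M (a', b')) mixed_support ?B {} p" if "a - p + 1 \<le> a'" "b \<le> b'" for a' b' p
  proof (cases "1 \<le> p")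
    case True
    then obtain i where i: "p = int i" "1 \<le> i" by (metis nonneg_int_cases order_trans zero_le_one of_nat_1 of_nat_le_iff)
    \<comment> \<open>The regularity condition for \<open>\<lambda>\<^sub>x = i - 1\<close> and \<open>\<lambda>\<^sub>y = 0\<close>.\<close>
    have "a - int (i - 1) \<le> a'" "b - int 0 \<le> b'" "i - 1 + 0 = i - 1" using that i by auto
    then have "local_cohomology_graded b_gens I i (a', b') = {zero_class b_gens I i}"
      using ab i(2) unfolding reg_def by blast
    then show ?thesis using b_vanishes_iff[OF I i(2)] i(1) by simp
  next
    case False
    then show ?thesis
      by (intro subgroup_system.exact_nonpos[OF subgroup_system_graded_localized_at[OF I]]) auto
  qed
  show "(a, b) \<in> x_reg I"
    unfolding x_reg_def
  proof (clarify)
    fix i :: nat and a' b' :: int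
    assume i: "1 \<le> i" and a': "a - int i + 1 \<le> a'" and b': "b \<le> b'"
    interpret subgroup_system "?M (a', b')" by (rule subgroup_system_graded_localized_at[OF I])
    have keys: "mixed_support (k, None) = {Inl k}" "mixed_support (k, Some j) = {Inl k, Inr j}" for k :: 'n and j :: 'm
      by (simp_all add: mixed_gens_def keys_mx_gens keys_b_gens)
    have local_exact: "cech_exact (?M (a', b')) mixed_support ?B (Inl ` V) q" if "V \<noteq> {}" for V q
      by (rule exact_localization[OF I that, of "a - q + 1"]) (rule b_exact[OF _ b'])
    have "cech_exact (?M (a', b')) mixed_support (?X \<union> ?B) {} (int i)"
    proof (rule exact_union[where P = "\<lambda>U. \<exists>V. V \<noteq> {} \<and> U = Inl ` V"])
      show "cech_exact (?M (a', b')) mixed_support ?B {} (int i)" by (rule b_exact[OF a' b'])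
      show "cech_exact (?M (a', b')) mixed_support ?B U q" if "\<exists>V. V \<noteq> {} \<and> U = Inl ` V" for U q
        using that local_exact by auto
      show "\<exists>V. V \<noteq> {} \<and> U \<union> mixed_support g = Inl ` V" if gU: "g \<in> ?X" "\<exists>V. V \<noteq> {} \<and> U = Inl ` V" for U g
      proof -
        obtain k V where "g = (k, None)" "U = Inl ` V" using gU by auto
        then show ?thesis by (intro exI[of _ "insert k V"]) (auto simp: keys)
      qed
      show "\<exists>V. V \<noteq> {} \<and> {} \<union> mixed_support g = Inl ` V" if gX: "g \<in> ?X" for g
      proof -
        obtain k where "g = (k, None)" using gX by auto
        then show ?thesis by (intro exI[of _ "{k}"]) (auto simp: keys)
      qed
    qed
    then have "cech_exact (?M (a', b')) mixed_support (?B \<union> ?X) {} (int i)"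
      by (subst Un_commute)
    moreover have "\<exists>x\<in>?X. mixed_support x \<subseteq> mixed_support g" if "g \<in> ?B" for g
    proof -
      obtain k j where "g = (k, Some j)" using \<open>g \<in> ?B\<close> by auto
      then show ?thesis by (intro bexI[of _ "(k, None)"]) (auto simp: keys)
    qed
    ultimately have "cech_exact (?M (a', b')) mixed_support ?X {} (int i)"
      by (rule exact_remove_multiples[rotated])
    then show "local_cohomology_graded mx_gens I i (a', b') = {zero_class mx_gens I i}"
      by (simp add: mx_vanishes_iff[OF I i])
  qed
qed

theorem theorem5p5:
  fixes I :: "('n::{finite,linorder}, 'm::{finite,linorder}, 'k::field_char_0) bipoly set"
  assumes "bihomogeneous_ideal I"
    and "I \<noteq> {0}"
  shows "\<exists>s::int. 0 \<le> s \<and> s \<le> int (cd_mx I) - 1 \<and>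
           (\<lambda>(a, b). (a + s, b)) ` reg I \<subseteq> x_reg I"
proof (intro exI[of _ 0] conjI)
  have "0 < card (UNIV :: 'n set)" by (simp add: card_gt_0_iff)
  then show "0 \<le> int (cd_mx I) - 1" using card_le_cd_mx[OF assms] by linarith
  show "(\<lambda>(a, b). (a + 0, b)) ` reg I \<subseteq> x_reg I"
    using reg_subset_x_reg[OF assms(1)] by auto
qed simp

end
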